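(* Let $(\mathcal X,d,\mu)$ be a doubling metric measure space (see context). Let $s\in(0,\infty)$ and $p,q\in(0,\infty]$. Then $\dot N^s_{p,q}(\mathcal X)=\dot B^s_{p,q}(\mathcal X)$, i.e. the two spaces coincide and their (quasi-semi)norms are comparable with constants independent of the function.
   Context: Setting: $(\mathcal X,d)$ is a metric space and $\mu$ a regular Borel measure on $\mathcal X$ such that all balls have finite and positive measure, and $\mu$ is doubling: there exist constants $C_1>1$ and $n>0$ such that $\mu(B(x,\lambda r))\le C_1\lambda^n\mu(B(x,r))$ for all $x\in\mathcal X$, $r\in(0,\infty)$, $\lambda\in(1,\infty)$. Functions are real-valued; $⨍_E f\,d\mu=\frac1{\mu(E)}\int_E f\,d\mu$; $u\in L^p_{\rm loc}(\mathcal X)$ means $u\in L^p(B)$ for each ball $B$. Besov space: $\dot B^s_{p,q}(\mathcal X)$ is the collection of all $u\in L^p_{\rm loc}(\mathcal X)$ with $$\|u\|_{\dot B^s_{p,q}(\mathcal X)}=\Big(\int_0^\infty\Big(\int_{\mathcal X}⨍_{B(x,t)}|u(x)-u(y)|^p\,d\mu(y)\,d\mu(x)\Big)^{q/p}\frac{dt}{t^{1+sq}}\Big)^{1/q}<\infty,$$ with the usual modification (essential suprema; for $q=\infty$, supremum over $t$ of $t^{-s}$ times the inner quantity) when $p=\infty$ or $q=\infty$. Fractional $s$-Hajłasz gradient: for a measurable function $u$ on $\mathcal X$, a sequence $\vec g=\{g_k\}_{k\in\mathbb Z}$ of nonnegative measurable functions belongs to $\mathbb D^s(u)$ if there is $E\subset\mathcal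 X$ with $\mu(E)=0$ such that for all $k\in\mathbb Z$ and all $x,y\in\mathcal X\setminus E$ with $2^{-k-1}\le d(x,y)<2^{-k}$, $|u(x)-u(y)|\le[d(x,y)]^s[g_k(x)+g_k(y)]$. Hajłasz-Besov space: $\dot N^s_{p,q}(\mathcal X)$ is the space of all measurable functions $u$ with $\|u\|_{\dot N^s_{p,q}(\mathcal X)}=\inf_{\vec g\in\mathbb D^s(u)}\|\vec g\|_{\ell^q(L^p(\mathcal X))}<\infty$, where $\|\vec g\|_{\ell^q(L^p(\mathcal X))}=\big\|\{\|g_k\|_{L^p(\mathcal X)}\}_{k\in\mathbb Z}\big\|_{\ell^q}$ (supremum over $k$ if $q=\infty$). *)

theory Defs
  imports "HOL-Probability.Essential_Supremum"
begin

section \<open>Doubling metric measure spaces\<close>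

text \<open>
  A \<^emph>\<open>regular Borel measure\<close> is understood in the sense of analysis on metric spaces: Borel sets
  are measurable, and every measurable set lies in a Borel set of the same measure. The
  \<open>\<sigma>\<close>-algebra may be strictly larger than the Borel one, so this covers measures defined on the Borel
  sets only as well as their completions. Outer regularity with respect to open sets implies this
  condition.
\<close>

definition regular_borel_measure :: "'a::metric_space measure \<Rightarrow> bool" where
  "regular_borel_measure M \<longleftrightarrow>
     space M = UNIV \<and> sets borel \<subseteq> sets M \<and>
     (\<forall>A\<in>sets M. \<exists>B\<in>sets borel. A \<subseteq> B \<and> emeasure M B = emeasure M A)"

definition doubling_metric_measure :: "'a::metric_space measure \<Rightarrow> bool" where
  "doubling_metric_measure M \<longleftrightarrow>
     regular_borel_measure M \<and>
     (\<forall>x r. 0 < r \<longrightarrow> 0 < emeasure M (ball x r) \<and> emeasure M (ball x r) < \<infinity>) \<and>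
     (\<exists>C1 n :: real. 1 < C1 \<and> 0 < n \<and>
        (\<forall>x r l. 0 < r \<longrightarrow> 1 < l \<longrightarrow>
           emeasure M (ball x (l * r)) \<le> ennreal (C1 * l powr n) * emeasure M (ball x r)))"


section \<open>Lebesgue and sequence quasi-norms\<close>

text \<open>Only used with exponents \<open>a > 0\<close>.\<close>

definition ennreal_powr :: "ennreal \<Rightarrow> real \<Rightarrow> ennreal" where
  "ennreal_powr x a = (if x = \<infinity> then \<infinity> else ennreal (enn2real x powr a))"

definition average :: "'a measure \<Rightarrow> 'a set \<Rightarrow> ('a \<Rightarrow> ennreal) \<Rightarrow> ennreal" where
  "average M A f = (\<integral>\<^sup>+y\<in>A. f y \<partial>M) / emeasure M A"

definition Lp_norm :: "ennreal \<Rightarrow> 'a measure \<Rightarrow> ('a \<Rightarrow> real) \<Rightarrow> ennreal" where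
  "Lp_norm p M f =
     (if p = \<infinity> then esssup M (\<lambda>x. ennreal \<bar>f x\<bar>)
      else ennreal_powr (\<integral>\<^sup>+x. ennreal (\<bar>f x\<bar> powr enn2real p) \<partial>M) (1 / enn2real p))"

definition lq_norm :: "ennreal \<Rightarrow> (int \<Rightarrow> ennreal) \<Rightarrow> ennreal" where
  "lq_norm q a =
     (if q = \<infinity> then (SUP k. a k)
      else ennreal_powr (\<integral>\<^sup>+k. ennreal_powr (a k) (enn2real q) \<partial>count_space UNIV) (1 / enn2real q))"

definition Lp_loc :: "ennreal \<Rightarrow> 'a::metric_space measure \<Rightarrow> ('a \<Rightarrow> real) set" where
  "Lp_loc p M =
     {u \<in> borel_measurable M. \<forall>x r. 0 < r \<longrightarrow> Lp_norm p (restrict_space M (ball x r)) u < \<infinity>}"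


section \<open>Besov spaces\<close>

definition besov_modulus ::
    "ennreal \<Rightarrow> 'a::metric_space measure \<Rightarrow> ('a \<Rightarrow> real) \<Rightarrow> real \<Rightarrow> ennreal" where
  "besov_modulus p M u t =
     (if p = \<infinity>
      then esssup M (\<lambda>x. esssup (restrict_space M (ball x t)) (\<lambda>y. ennreal \<bar>u x - u y\<bar>))
      else ennreal_powr
             (\<integral>\<^sup>+x. average M (ball x t) (\<lambda>y. ennreal (\<bar>u x - u y\<bar> powr enn2real p)) \<partial>M)
             (1 / enn2real p))"

text \<open>The exponent \<open>q/p\<close> is split: the power \<open>1/p\<close> is part of \<open>besov_modulus\<close>.\<close>

definition besov_norm ::
    "'a::metric_space measure \<Rightarrow> real \<Rightarrow> ennreal \<Rightarrow> ennreal \<Rightarrow> ('a \<Rightarrow> real) \<Rightarrow> ennreal" where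
  "besov_norm M s p q u =
     (if q = \<infinity> then (SUP t\<in>{0<..}. ennreal (t powr (- s)) * besov_modulus p M u t)
      else ennreal_powr
             (\<integral>\<^sup>+t\<in>{0<..}. ennreal_powr (besov_modulus p M u t) (enn2real q)
                           / ennreal (t powr (1 + s * enn2real q)) \<partial>lborel)
             (1 / enn2real q))"

definition besov_space ::
    "'a::metric_space measure \<Rightarrow> real \<Rightarrow> ennreal \<Rightarrow> ennreal \<Rightarrow> ('a \<Rightarrow> real) set" where
  "besov_space M s p q = {u \<in> Lp_loc p M. besov_norm M s p q u < \<infinity>}"


section \<open>Hajlasz-Besov spaces\<close>

definition hajlasz_gradients ::
    "'a::metric_space measure \<Rightarrow> real \<Rightarrow> ('a \<Rightarrow> real) \<Rightarrow> (int \<Rightarrow> 'a \<Rightarrow> real) set" where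
  "hajlasz_gradients M s u =
     {g. (\<forall>k. g k \<in> borel_measurable M \<and> (\<forall>x. 0 \<le> g k x)) \<and>
         (\<exists>E\<in>null_sets M. \<forall>k x y. x \<notin> E \<longrightarrow> y \<notin> E \<longrightarrow>
            2 powi (- k - 1) \<le> dist x y \<longrightarrow> dist x y < 2 powi (- k) \<longrightarrow>
            \<bar>u x - u y\<bar> \<le> dist x y powr s * (g k x + g k y))}"

definition hajlasz_besov_norm ::
    "'a::metric_space measure \<Rightarrow> real \<Rightarrow> ennreal \<Rightarrow> ennreal \<Rightarrow> ('a \<Rightarrow> real) \<Rightarrow> ennreal" where
  "hajlasz_besov_norm M s p q u =
     (INF g\<in>hajlasz_gradients M s u. lq_norm q (\<lambda>k. Lp_norm p M (g k)))"

definition hajlasz_besov_space ::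
    "'a::metric_space measure \<Rightarrow> real \<Rightarrow> ennreal \<Rightarrow> ennreal \<Rightarrow> ('a \<Rightarrow> real) set" where
  "hajlasz_besov_space M s p q =
     {u \<in> borel_measurable M. hajlasz_besov_norm M s p q u < \<infinity>}"

end

theory Submission
  imports Defs
begin

text \<open>
  Both quasi-norms are compared with the \<open>\<ell>\<^sup>q\<close> quasi-norm of the sequence
  \<open>2\<^bsup>sk\<^esup> \<omega>(2\<^bsup>-k\<^esup>)\<close>, where \<open>\<omega>\<close> is the Besov modulus; by doubling \<open>\<omega>\<close> varies
  by bounded factors on dyadic intervals, so for the Besov side only sums over \<open>k\<close> matter. Averaging
  \<open>\<bar>u x - u y\<bar> \<le> \<bar>u x - u z\<bar> + \<bar>u z - u y\<bar>\<close> over \<open>z\<close> in a ball shows that multiples of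
  the mean oscillations of \<open>u\<close> over balls of radius \<open>2\<^bsup>1-k\<^esup>\<close> form a fractional gradient.
  Conversely, the gradient inequality at all scales \<open>2\<^bsup>-k-i\<^esup>\<close> and Tonelli's theorem bound
  \<open>2\<^bsup>sk\<^esup> \<omega>(2\<^bsup>-k\<^esup>)\<close> by a geometrically weighted supremum of the norms of
  \<open>g\<^bsub>k+i\<^esub>\<close>, to which a discrete Hardy inequality applies. Joint measurability of the ball
  indicators, needed for Tonelli, rests on the separability of doubling spaces.
\<close>

section \<open>Powers of extended reals and sequence quasi-norms\<close>

text \<open>For exponents below 1 there is no triangle inequality, so sums are split by x + y <= 2
  max x y; this costs a power of 2 but treats all finite exponents alike. The comparison of moduli
  is one-sided: a mean over a ball is controlled by the mean over a ball up to twice as large, not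
  conversely. Hence the Besov integral is bounded from above through right end points of dyadic
  intervals and from below through left end points, which shifts the index by one. A fractional
  gradient is real valued, whereas a mean oscillation may be infinite. The gradient can therefore be
  built only once every dyadic modulus is known to be finite; the infinite values then fill a null
  set. The factor 2^(-s i) is split into two halves: for finite p one half makes the series over i
  converge, and the other half remains as the weight in the Hardy inequality. This is why s / 2
  appears.\<close>

lemma ennreal_powr_ennreal: "0 \<le> x \<Longrightarrow> ennreal_powr (ennreal x) a = ennreal (x powr a)"
  by (simp add: ennreal_powr_def)

lemma ennreal_powr_top [simp]: "ennreal_powr top a = top"
  by (simp add: ennreal_powr_def)

lemma ennreal_powr_zero [simp]: "ennreal_powr 0 a = 0"
  by (simp add: ennreal_powr_def)

lemma ennreal_powr_one: "ennreal_powr x 1 = x"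
  by (cases x) (auto simp: ennreal_powr_ennreal)

lemma ennreal_powr_less_top_iff [simp]: "ennreal_powr x a < top \<longleftrightarrow> x < top"
  by (auto simp: ennreal_powr_def less_top)

lemma ennreal_powr_eq_zero_iff [simp]: "ennreal_powr x a = 0 \<longleftrightarrow> x = 0"
  by (auto simp: ennreal_powr_def enn2real_eq_0_iff)

lemma ennreal_powr_mono: "0 \<le> a \<Longrightarrow> x \<le> y \<Longrightarrow> ennreal_powr x a \<le> ennreal_powr y a"
  by (auto simp: ennreal_powr_def top_unique less_top intro!: ennreal_leI powr_mono2 enn2real_mono)

text \<open>The conventions that send 0 to 0 and \<open>top\<close> to \<open>top\<close>, together
  with 0 * \<open>top\<close> = 0, make the identity hold for every real exponent and at the extreme
  values.\<close>

lemma ennreal_powr_mult: "ennreal_powr (x * y) a = ennreal_powr x a * ennreal_powr y a"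
proof (cases "x = 0 \<or> y = 0 \<or> x = top \<or> y = top")
  case True
  then show ?thesis by (auto simp: ennreal_top_mult ennreal_mult_top)
next
  case False
  then obtain r t where "x = ennreal r" "0 \<le> r" "y = ennreal t" "0 \<le> t"
    by (cases x; cases y) auto
  then show ?thesis
    by (simp add: ennreal_powr_ennreal powr_mult ennreal_mult flip: ennreal_mult)
qed

lemma ennreal_powr_powr: "ennreal_powr (ennreal_powr x a) b = ennreal_powr x (a * b)"
  by (cases x) (auto simp: ennreal_powr_ennreal powr_powr)

lemma ennreal_powr_le_iff:
  assumes "0 < a"
  shows "ennreal_powr x a \<le> y \<longleftrightarrow> x \<le> ennreal_powr y (1 / a)"
proof
  assume "ennreal_powr x a \<le> y"
  from ennreal_powr_mono[OF _ this, of "1 / a"] show "x \<le> ennreal_powr y (1 / a)"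
    using assms by (simp add: ennreal_powr_powr ennreal_powr_one)
next
  assume "x \<le> ennreal_powr y (1 / a)"
  from ennreal_powr_mono[OF _ this, of a] show "ennreal_powr x a \<le> y"
    using assms by (simp add: ennreal_powr_powr ennreal_powr_one)
qed

text \<open>The substitute for convexity when \<open>a\<close> is at least 1 and for subadditivity
  when it is smaller: the sum is replaced by twice the maximum.\<close>

lemma ennreal_powr_add_le:
  assumes "0 \<le> a"
  shows "ennreal_powr (x + y) a \<le> ennreal (2 powr a) * (ennreal_powr x a + ennreal_powr y a)"
proof -
  have "x + y \<le> ennreal 2 * max x y"
    by (simp add: mult_2 add_mono)
  then have "ennreal_powr (x + y) a \<le> ennreal_powr (ennreal 2 * max x y) a"
    by (rule ennreal_powr_mono[OF assms])
  also have "\<dots> = ennreal (2 powr a) * ennreal_powr (max x y) a"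
    unfolding ennreal_powr_mult using ennreal_powr_ennreal[of 2 a] by simp
  also have "\<dots> \<le> ennreal (2 powr a) * (ennreal_powr x a + ennreal_powr y a)"
    by (intro mult_left_mono) (auto simp: max_def)
  finally show ?thesis .
qed

lemma borel_measurable_ennreal_powr [measurable]:
  assumes [measurable]: "f \<in> borel_measurable N"
  shows "(\<lambda>x. ennreal_powr (f x) a) \<in> borel_measurable N"
  unfolding ennreal_powr_def by measurable

lemma enn2real_exponent_pos: "0 < p \<Longrightarrow> p \<noteq> \<infinity> \<Longrightarrow> 0 < enn2real p"
  by (simp add: enn2real_positive_iff less_top)

section \<open>Sequence quasi-norms: monotonicity, shifts and the Hardy inequality\<close>

lemma lq_norm_mono_mult:
  assumes "0 < q" and le: "\<And>k. a k \<le> c * b k"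
  shows "lq_norm q a \<le> c * lq_norm q b"
proof (cases "q = \<infinity>")
  case True
  have "(SUP k. a k) \<le> (SUP k. c * b k)"
    by (intro SUP_mono) (use le in auto)
  then show ?thesis
    using True by (simp add: lq_norm_def SUP_mult_left_ennreal)
next
  case False
  define Q where "Q = enn2real q"
  have Q: "0 < Q"
    unfolding Q_def using assms(1) False by (rule enn2real_exponent_pos)
  have "(\<integral>\<^sup>+k. ennreal_powr (a k) Q \<partial>count_space UNIV)
      \<le> (\<integral>\<^sup>+k. ennreal_powr c Q * ennreal_powr (b k) Q \<partial>count_space UNIV)"
    using Q by (intro nn_integral_mono) (auto simp flip: ennreal_powr_mult intro!: ennreal_powr_mono le)
  also have "\<dots> = ennreal_powr c Q * (\<integral>\<^sup>+k. ennreal_powr (b k) Q \<partial>count_space UNIV)"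
    by (simp add: nn_integral_cmult)
  finally have "ennreal_powr (\<integral>\<^sup>+k. ennreal_powr (a k) Q \<partial>count_space UNIV) (1 / Q)
     \<le> ennreal_powr (ennreal_powr c Q * (\<integral>\<^sup>+k. ennreal_powr (b k) Q \<partial>count_space UNIV)) (1 / Q)"
    using Q by (intro ennreal_powr_mono) auto
  then show ?thesis
    using False Q
    by (simp add: lq_norm_def ennreal_powr_mult ennreal_powr_powr ennreal_powr_one flip: Q_def)
qed

lemma lq_norm_shift: "lq_norm q (\<lambda>k. a (k + j)) = lq_norm q a"
proof -
  have bij: "bij_betw (\<lambda>k. k + j) UNIV (UNIV :: int set)"
    by (rule bij_betwI[of _ _ _ "\<lambda>k. k - j"]) auto
  have "(SUP k. a (k + j)) = (SUP k. a k)"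
    using bij_betw_imp_surj_on[OF bij] by (simp add: image_image[of a "\<lambda>k. k + j" UNIV, symmetric])
  then show ?thesis
    using nn_integral_bij_count_space[OF bij, of "\<lambda>k. ennreal_powr (a k) (enn2real q)"]
    by (simp add: lq_norm_def)
qed

text \<open>Turns finiteness of the sequence norm into finiteness of each dyadic modulus, on which
  the gradient construction and local integrability rest.\<close>

lemma component_le_lq_norm:
  assumes "0 < q"
  shows "a k \<le> lq_norm q a"
proof (cases "q = \<infinity>")
  case True
  then show ?thesis by (auto simp: lq_norm_def intro: SUP_upper)
next
  case False
  have "ennreal_powr (a k) (enn2real q) \<le> (\<integral>\<^sup>+k. ennreal_powr (a k) (enn2real q) \<partial>count_space UNIV)"
    by (rule nn_integral_ge_point) simp
  then show ?thesis
    using False enn2real_exponent_pos[OF assms False]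
    by (simp add: lq_norm_def ennreal_powr_le_iff)
qed

text \<open>
  Taking a supremum of geometrically weighted terms instead of their
  sum makes one argument work for all exponents, without distinguishing \<open>q < 1\<close> from \<open>q \<ge> 1\<close>.
\<close>

lemma lq_norm_Hardy:
  fixes e :: real
  assumes "0 < q" and "0 < e"
  shows "\<exists>C>0. \<forall>a b. (\<forall>k. a k \<le> (SUP i::nat. ennreal (2 powr (- e * i)) * b (k + int i)))
    \<longrightarrow> lq_norm q a \<le> ennreal C * lq_norm q b"
proof (cases "q = \<infinity>")
  case True
  have "lq_norm q a \<le> ennreal 1 * lq_norm q b"
    if "\<forall>k. a k \<le> (SUP i::nat. ennreal (2 powr (- e * i)) * b (k + int i))" for a b
  proof -
    have "a k \<le> (SUP j. b j)" for k
    proof -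
      have "a k \<le> (SUP i::nat. ennreal (2 powr (- e * i)) * b (k + int i))"
        using that by blast
      also have "\<dots> \<le> (SUP j. b j)"
      proof (intro SUP_least)
        fix i :: nat
        have "(2::real) powr (- e * i) \<le> 2 powr 0"
          using assms(2) by (intro powr_mono) auto
        then have "ennreal (2 powr (- e * i)) * b (k + int i) \<le> 1 * b (k + int i)"
          by (intro mult_right_mono) auto
        also have "\<dots> \<le> (SUP j. b j)"
          by (auto intro: SUP_upper)
        finally show "ennreal (2 powr (- e * i)) * b (k + int i) \<le> (SUP j. b j)" .
      qed
      finally show ?thesis .
    qed
    then show ?thesis
      using True by (auto simp: lq_norm_def intro: SUP_least)
  qed
  then show ?thesis
    by (intro exI[of _ 1]) auto
next
  case False
  define Q where "Q = enn2real q"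
  have Q: "0 < Q"
    unfolding Q_def using assms(1) False by (rule enn2real_exponent_pos)
  \<comment> \<open>The Q-th power of the weight 2^(-e), so that the weight of the i-th term becomes
    \<open>r ^ i\<close>.\<close>
  define r :: real where "r = 2 powr (- e * Q)"
  have r: "0 < r" "r < 1"
    using Q assms(2) by (auto simp: r_def powr_less_one mult_pos_pos intro!: powr_less_one)
  define S where "S = 1 / (1 - r)"
  have S: "0 < S" "(\<Sum>i. ennreal (r ^ i)) = ennreal S"
    using r by (auto simp: S_def intro!: suminf_ennreal_eq geometric_sums)
  have "lq_norm q a \<le> ennreal (S powr (1 / Q)) * lq_norm q b"
    if ab: "\<forall>k. a k \<le> (SUP i::nat. ennreal (2 powr (- e * i)) * b (k + int i))" for a b
  proof -
    define I where "I = (\<integral>\<^sup>+k. ennreal_powr (b k) Q \<partial>count_space UNIV)"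
    \<comment> \<open>The Q-th power of a supremum is at most the sum of the Q-th powers, whatever
      the size of Q. After that, sums over k and i can be exchanged and each shifted copy of
      \<open>b\<close> contributes the same amount \<open>I\<close>.\<close>
    have "ennreal_powr (a k) Q \<le> (\<Sum>i. ennreal (r ^ i) * ennreal_powr (b (k + int i)) Q)" for k
    proof -
      have "ennreal (2 powr (- e * i)) * b (k + int i)
         \<le> ennreal_powr (\<Sum>i. ennreal (r ^ i) * ennreal_powr (b (k + int i)) Q) (1 / Q)" for i :: nat
      proof -
        have "(2 powr (- e * i)) powr Q = r ^ i"
          using r by (simp add: r_def powr_powr powr_realpow[symmetric] mult_ac)
        then have "ennreal_powr (ennreal (2 powr (- e * i)) * b (k + int i)) Q
            = ennreal (r ^ i) * ennreal_powr (b (k + int i)) Q"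
          by (simp add: ennreal_powr_mult ennreal_powr_ennreal)
        also have "\<dots> \<le> (\<Sum>i. ennreal (r ^ i) * ennreal_powr (b (k + int i)) Q)"
          using sum_le_suminf[of "\<lambda>i. ennreal (r ^ i) * ennreal_powr (b (k + int i)) Q" "{i}"] by simp
        finally show ?thesis
          using Q by (simp add: ennreal_powr_le_iff)
      qed
      then show ?thesis
        using Q ab by (subst ennreal_powr_le_iff) (auto intro!: order_trans[OF spec[OF ab]] SUP_least)
    qed
    then have "(\<integral>\<^sup>+k. ennreal_powr (a k) Q \<partial>count_space UNIV)
       \<le> (\<integral>\<^sup>+k. (\<Sum>i. ennreal (r ^ i) * ennreal_powr (b (k + int i)) Q) \<partial>count_space UNIV)"
      by (intro nn_integral_mono) auto
    also have "\<dots> = (\<Sum>i. \<integral>\<^sup>+k. ennreal (r ^ i) * ennreal_powr (b (k + int i)) Q \<partial>count_space UNIV)"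
      by (rule nn_integral_suminf) auto
    also have "\<dots> = (\<Sum>i. ennreal (r ^ i) * I)"
    proof (rule suminf_cong)
      fix i :: nat
      have "bij_betw (\<lambda>k. k + int i) UNIV UNIV"
        by (rule bij_betwI[of _ _ _ "\<lambda>k. k - int i"]) auto
      from nn_integral_bij_count_space[OF this, of "\<lambda>k. ennreal_powr (b k) Q"]
      show "(\<integral>\<^sup>+k. ennreal (r ^ i) * ennreal_powr (b (k + int i)) Q \<partial>count_space UNIV) = ennreal (r ^ i) * I"
        by (simp add: nn_integral_cmult I_def)
    qed
    also have "\<dots> = ennreal S * I"
      using S by simp
    finally have "ennreal_powr (\<integral>\<^sup>+k. ennreal_powr (a k) Q \<partial>count_space UNIV) (1 / Q)
       \<le> ennreal_powr (ennreal S * I) (1 / Q)"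
      using Q by (intro ennreal_powr_mono) auto
    then show ?thesis
      using False S by (simp add: lq_norm_def I_def ennreal_powr_mult ennreal_powr_ennreal flip: Q_def)
  qed
  moreover have "0 < S powr (1 / Q)"
    using S by simp
  ultimately show ?thesis
    by blast
qed

section \<open>Separability and measurability in doubling spaces\<close>

text \<open>Zorn's lemma; the covering property is maximality, since a point at distance at least
  \<open>e\<close> from all of S could be inserted into S.\<close>

lemma ex_maximal_separated_set:
  "\<exists>S :: 'a::metric_space set. (\<forall>x\<in>S. \<forall>y\<in>S. x \<noteq> y \<longrightarrow> e \<le> dist x y) \<and> (\<forall>x. x \<in> S \<or> (\<exists>y\<in>S. dist x y < e))"
proof -
  define F where "F = {S :: 'a set. \<forall>x\<in>S. \<forall>y\<in>S. x \<noteq> y \<longrightarrow> e \<le> dist x y}"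
  have "\<exists>S\<in>F. \<forall>X\<in>F. S \<subseteq> X \<longrightarrow> X = S"
  proof (rule subset_Zorn')
    fix C assume C: "subset.chain F C"
    have "e \<le> dist x y" if "X \<in> C" "Y \<in> C" "x \<in> X" "y \<in> Y" "x \<noteq> y" for x y X Y
    proof -
      have "X \<subseteq> Y \<or> Y \<subseteq> X"
        using C that by (auto simp: subset_chain_def)
      moreover have "X \<in> F" "Y \<in> F"
        using C that by (auto simp: subset_chain_def)
      ultimately show ?thesis
        using that unfolding F_def by blast
    qed
    then show "\<Union>C \<in> F"
      by (auto simp: F_def)
  qed
  then obtain S where S: "S \<in> F" and max: "\<And>X. X \<in> F \<Longrightarrow> S \<subseteq> X \<Longrightarrow> X = S"
    by blast
  have "x \<in> S \<or> (\<exists>y\<in>S. dist x y < e)" for x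
  proof (rule ccontr)
    assume "\<not> ?thesis"
    then have "x \<notin> S" "insert x S \<in> F"
      using S by (auto simp: F_def not_less dist_commute)
    then show False
      using max[of "insert x S"] by auto
  qed
  with S show ?thesis
    unfolding F_def by blast
qed

lemma esssup_le_iff:
  "f \<in> borel_measurable N \<Longrightarrow> esssup N f \<le> c \<longleftrightarrow> (AE x in N. f x \<le> c)"
  using esssup_AE[of f N] by (auto elim!: eventually_mono)

text \<open>Of the doubling condition only the factor 2 is kept; \<open>doubling_power\<close>
  recovers the powers of 2 by iteration.\<close>

locale doubling_space =
  fixes M :: "'a::metric_space measure" and D :: real
  assumes space_M [simp]: "space M = UNIV"
    and sets_borel_le: "sets borel \<subseteq> sets M"
    and emeasure_ball_pos: "0 < r \<Longrightarrow> 0 < emeasure M (ball x r)"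
    and emeasure_ball_finite: "emeasure M (ball x r) < top"
    and D_ge_1: "1 \<le> D"
    and doubling: "0 < r \<Longrightarrow> emeasure M (ball x (2 * r)) \<le> ennreal D * emeasure M (ball x r)"
begin

lemma sets_open [measurable]: "open A \<Longrightarrow> A \<in> sets M"
  using sets_borel_le by auto

lemma ball_sets [measurable, simp]: "ball x r \<in> sets M"
  by (intro sets_open) auto

lemma emeasure_ball_mono: "ball x r \<subseteq> ball y t \<Longrightarrow> emeasure M (ball x r) \<le> emeasure M (ball y t)"
  by (intro emeasure_mono) auto

lemma doubling_power: "0 < r \<Longrightarrow> emeasure M (ball x (2 ^ m * r)) \<le> ennreal (D ^ m) * emeasure M (ball x r)"
proof (induction m)
  case (Suc m)
  have "emeasure M (ball x (2 ^ Suc m * r)) \<le> ennreal D * emeasure M (ball x (2 ^ m * r))"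
    using doubling[of "2 ^ m * r" x] Suc.prems by (simp add: mult.assoc)
  also have "\<dots> \<le> ennreal D * (ennreal (D ^ m) * emeasure M (ball x r))"
    using Suc by (intro mult_left_mono) auto
  finally show ?case
    using D_ge_1 by (simp add: ennreal_mult mult.assoc)
qed simp

text \<open>A packing argument: balls of radius e/2 about points of S are disjoint and lie in one
  ball of measure V, while doubling makes each of them have measure at least V / D^m. So no finite
  subset of S has more than D^m points.\<close>

lemma finite_separated_in_ball:
  assumes e: "0 < e" and sep: "\<And>x y. x \<in> S \<Longrightarrow> y \<in> S \<Longrightarrow> x \<noteq> y \<Longrightarrow> e \<le> dist x y"
    and S: "S \<subseteq> ball x0 R"
  shows "finite (S :: 'a set)"
proof (cases "0 < R")
  case False
  then have "ball x0 R = {}" by simp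
  then have "S = {}" using S by blast
  then show ?thesis by simp
next
  case True
  \<comment> \<open>A point of \<open>ball x0 (R + e)\<close> is within R + (R + e) of any point of
    S; m doublings of e/2 exceed this distance.\<close>
  obtain m :: nat where m: "(2 * R + e) / (e / 2) < 2 ^ m"
    using real_arch_pow[of 2] by auto
  define V where "V = emeasure M (ball x0 (R + e))"
  have V: "0 < V" "V < top"
    unfolding V_def using True e by (auto intro!: emeasure_ball_pos simp: emeasure_ball_finite)
  have lower: "V \<le> ennreal (D ^ m) * emeasure M (ball x (e / 2))" if "x \<in> S" for x
  proof -
    have "ball x0 (R + e) \<subseteq> ball x (2 ^ m * (e / 2))"
    proof
      fix y assume "y \<in> ball x0 (R + e)"
      moreover have "dist x y \<le> dist x0 x + dist x0 y"
        by (metis dist_commute dist_triangle)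
      moreover have "2 * R + e < 2 ^ m * (e / 2)"
        using m e by (simp add: field_simps)
      ultimately show "y \<in> ball x (2 ^ m * (e / 2))"
        using that S by auto
    qed
    then have "V \<le> emeasure M (ball x (2 ^ m * (e / 2)))"
      unfolding V_def by (rule emeasure_ball_mono)
    also have "\<dots> \<le> ennreal (D ^ m) * emeasure M (ball x (e / 2))"
      using e by (intro doubling_power) auto
    finally show ?thesis .
  qed
  have "card G \<le> nat \<lceil>D ^ m\<rceil>" if G: "G \<subseteq> S" "finite G" for G
  proof -
    have "disjoint_family_on (\<lambda>x. ball x (e / 2)) G"
      unfolding disjoint_family_on_def
    proof (intro ballI impI)
      fix x y assume "x \<in> G" "y \<in> G" "x \<noteq> y"
      then have "e \<le> dist x y"
        using sep G by auto
      then show "ball x (e / 2) \<inter> ball y (e / 2) = {}"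
        by (intro disjoint_ballI) auto
    qed
    then have "(\<Sum>x\<in>G. emeasure M (ball x (e / 2))) = emeasure M (\<Union>x\<in>G. ball x (e / 2))"
      using G by (intro sum_emeasure) auto
    also have "\<dots> \<le> V"
      unfolding V_def
    proof (intro emeasure_mono subsetI)
      fix y assume "y \<in> (\<Union>x\<in>G. ball x (e / 2))"
      then obtain x where x: "x \<in> G" "dist x y < e / 2"
        by auto
      then have "dist x0 x < R" "dist x0 y \<le> dist x0 x + dist x y"
        using G S by (auto simp: dist_triangle)
      then show "y \<in> ball x0 (R + e)"
        using x e by auto
    qed auto
    finally have 1: "(\<Sum>x\<in>G. emeasure M (ball x (e / 2))) \<le> V" .
    have "of_nat (card G) * V \<le> (\<Sum>x\<in>G. ennreal (D ^ m) * emeasure M (ball x (e / 2)))"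
      using G by (subst sum_constant[symmetric]) (intro sum_mono lower, auto)
    also have "\<dots> \<le> ennreal (D ^ m) * V"
      unfolding sum_distrib_left[symmetric] by (intro mult_left_mono 1) auto
    finally have "V * of_nat (card G) \<le> V * ennreal (D ^ m)"
      by (simp add: mult.commute)
    \<comment> \<open>Cancelling V is possible because it is positive and finite.\<close>
    then have "ennreal (real (card G)) \<le> ennreal (D ^ m)"
      using V by (subst (asm) ennreal_mult_le_mult_iff) (auto simp: ennreal_of_nat_eq_real_of_nat)
    then have "real (card G) \<le> D ^ m"
      using D_ge_1 by (simp add: ennreal_le_iff)
    then show ?thesis
      by linarith
  qed
  then show ?thesis
    using finite_if_finite_subsets_card_bdd by blast
qed

text \<open>Maximal separated sets at the scales 1/(n+1) are countable, being exhausted by their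
  finite intersections with balls of integer radius; their union is dense.\<close>

lemma ex_countable_dense: "\<exists>Z :: 'a set. countable Z \<and> (\<forall>x e. 0 < e \<longrightarrow> (\<exists>z\<in>Z. dist x z < e))"
proof -
  have "\<exists>S :: 'a set. countable S \<and> (\<forall>x. \<exists>z\<in>S. dist x z < e)" if e: "0 < e" for e :: real
  proof -
    obtain S :: "'a set" where S: "(\<forall>x\<in>S. \<forall>y\<in>S. x \<noteq> y \<longrightarrow> e \<le> dist x y) \<and> (\<forall>x. x \<in> S \<or> (\<exists>y\<in>S. dist x y < e))"
      using ex_maximal_separated_set by (rule exE)
    then have sep: "e \<le> dist x y" if "x \<in> S" "y \<in> S" "x \<noteq> y" for x y
      using that by blast
    have max: "x \<in> S \<or> (\<exists>y\<in>S. dist x y < e)" for x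
      using S by blast
    have fin: "finite (S \<inter> ball x0 (real n))" for x0 n
      by (rule finite_separated_in_ball[OF e _ Int_lower2]) (use sep in auto)
    \<comment> \<open>\<open>undefined\<close> serves as an arbitrary base point.\<close>
    have "S = (\<Union>n. S \<inter> ball undefined (real n))"
      using reals_Archimedean2 by auto
    moreover have "countable (\<Union>n. S \<inter> ball undefined (real n))"
      by (intro countable_UN) (auto intro: countable_finite fin)
    ultimately have "countable S"
      by metis
    moreover have "\<exists>z\<in>S. dist x z < e" for x
      using max[of x] e by force
    ultimately show ?thesis
      by blast
  qed
  then have "\<forall>n. \<exists>S :: 'a set. countable S \<and> (\<forall>x. \<exists>z\<in>S. dist x z < 1 / real (Suc n))"
    by simp
  then obtain S where S: "\<And>n. countable (S n)" "\<And>n x::'a. \<exists>z\<in>S n. dist x z < 1 / real (Suc n)"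
    by metis
  show ?thesis
  proof (intro exI[of _ "\<Union>n. S n"] conjI allI impI)
    show "countable (\<Union>n. S n)"
      using S by auto
    fix x :: 'a and e :: real
    assume "0 < e"
    then obtain n where "1 / real (Suc n) < e"
      using nat_approx_posE by blast
    with S(2)[where n=n and x=x] show "\<exists>z\<in>\<Union>n. S n. dist x z < e"
      by force
  qed
qed

section \<open>Sigma-finiteness and measurability on the product space\<close>

sublocale sigma_finite_measure M
proof
  let ?A = "range (\<lambda>n::nat. ball (undefined::'a) (real n))"
  have "\<Union>?A = UNIV"
    using reals_Archimedean2 by auto
  then show "\<exists>A. countable A \<and> A \<subseteq> sets M \<and> \<Union>A = space M \<and> (\<forall>a\<in>A. emeasure M a \<noteq> \<infinity>)"
    using emeasure_ball_finite by (intro exI[of _ ?A]) (auto simp: less_top)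
qed

sublocale square: pair_sigma_finite M M ..

text \<open>The set is open in the product, but the product sigma-algebra is generated by measurable
  rectangles and need not contain all open sets. Separability lets the set be written as a countable
  union of products of balls.\<close>

lemma dist_less_sets: "{z. dist (fst z) (snd z) < t} \<in> sets (M \<Otimes>\<^sub>M M)"
proof -
  obtain Z :: "'a set" where Z: "countable Z" "\<And>x e. 0 < e \<Longrightarrow> \<exists>z\<in>Z. dist x z < e"
    using ex_countable_dense by blast
  have "{z. dist (fst z) (snd z) < t} = (\<Union>z\<in>Z. \<Union>r\<in>\<rat>. ball z r \<times> ball z (t - r))"
  proof (intro equalityI subsetI)
    fix w :: "'a \<times> 'a" assume "w \<in> {z. dist (fst z) (snd z) < t}"
    then obtain x y where w: "w = (x, y)" and xy: "dist x y < t"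
      by (cases w) auto
    \<comment> \<open>With dist x y = t - 3 e, a dense point z within e of x and a rational r
      between e and 2 e, the distance from z to y is below t - 2 e and hence below t - r.\<close>
    define e where "e = (t - dist x y) / 3"
    have e: "0 < e" using xy by (simp add: e_def)
    obtain z where z: "z \<in> Z" "dist x z < e"
      using Z(2)[OF e] by blast
    obtain r where r: "r \<in> \<rat>" "e < r" "r < 2 * e"
      using Rats_dense_in_real[of e "2 * e"] e by auto
    have "dist z y \<le> dist x z + dist x y"
      by (metis dist_commute dist_triangle)
    also have "\<dots> < t - r"
      using z r by (simp add: e_def field_simps)
    finally have "w \<in> ball z r \<times> ball z (t - r)"
      using w z r by (simp add: dist_commute)
    then show "w \<in> (\<Union>z\<in>Z. \<Union>r\<in>\<rat>. ball z r \<times> ball z (t - r))"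
      using z r by blast
  next
    fix w :: "'a \<times> 'a" assume "w \<in> (\<Union>z\<in>Z. \<Union>r\<in>\<rat>. ball z r \<times> ball z (t - r))"
    then obtain z r where "dist z (fst w) < r" "dist z (snd w) < t - r"
      by auto
    moreover have "dist (fst w) (snd w) \<le> dist z (fst w) + dist z (snd w)"
      by (metis dist_commute dist_triangle)
    ultimately show "w \<in> {z. dist (fst z) (snd z) < t}"
      by simp
  qed
  also have "\<dots> \<in> sets (M \<Otimes>\<^sub>M M)"
    using Z(1) by (intro sets.countable_UN'' countable_rat pair_measureI) auto
  finally show ?thesis .
qed

lemma indicator_ball_measurable [measurable]:
  "(\<lambda>z. indicator (ball (fst z) t) (snd z) :: ennreal) \<in> borel_measurable (M \<Otimes>\<^sub>M M)"
proof -
  have "(\<lambda>z :: 'a \<times> 'a. indicator (ball (fst z) t) (snd z) :: ennreal) = indicator {z. dist (fst z) (snd z) < t}"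
    by (auto simp: indicator_def)
  then show ?thesis
    using dist_less_sets[of t] by (simp only: borel_measurable_indicator)
qed

lemma set_nn_integral_ball_measurable:
  assumes [measurable]: "case_prod f \<in> borel_measurable (M \<Otimes>\<^sub>M M)"
  shows "(\<lambda>x. \<integral>\<^sup>+y\<in>ball x t. f x y \<partial>M) \<in> borel_measurable M"
proof -
  have "(\<lambda>z. case_prod f z * indicator (ball (fst z) t) (snd z)) \<in> borel_measurable (M \<Otimes>\<^sub>M M)"
    by measurable
  then have "(\<lambda>(x, y). f x y * indicator (ball x t) y) \<in> borel_measurable (M \<Otimes>\<^sub>M M)"
    by (simp add: case_prod_unfold)
  then show ?thesis
    by (rule borel_measurable_nn_integral[where f = "\<lambda>x y. f x y * indicator (ball x t) y"])
qed

lemma emeasure_ball_measurable [measurable]: "(\<lambda>x. emeasure M (ball x t)) \<in> borel_measurable M"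
  using set_nn_integral_ball_measurable[of "\<lambda>x y. 1" t] by simp

text \<open>A sublevel set consists of the x for which the part of the ball where \<open>f x\<close>
  exceeds c has measure zero. That measure is an integral depending measurably on x, so the claim
  reduces to \<open>set_nn_integral_ball_measurable\<close>.\<close>

lemma esssup_ball_measurable:
  fixes f :: "'a \<Rightarrow> 'a \<Rightarrow> ennreal"
  assumes f [measurable]: "case_prod f \<in> borel_measurable (M \<Otimes>\<^sub>M M)"
  shows "(\<lambda>x. esssup (restrict_space M (ball x t)) (f x)) \<in> borel_measurable M"
proof (rule borel_measurableI_le)
  fix c :: ennreal
  have [measurable]: "f x \<in> borel_measurable M" for x
    using measurable_compose_Pair1[OF _ f, of x] by simp
  have "esssup (restrict_space M (ball x t)) (f x) \<le> c \<longleftrightarrow>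
      (\<integral>\<^sup>+y\<in>ball x t. indicator {c<..} (f x y) \<partial>M) = 0" for x
  proof -
    have "esssup (restrict_space M (ball x t)) (f x) \<le> c \<longleftrightarrow> (AE y in M. y \<in> ball x t \<longrightarrow> f x y \<le> c)"
      by (subst esssup_le_iff) (auto simp: AE_restrict_space_iff intro!: measurable_restrict_space1)
    also have "\<dots> \<longleftrightarrow> (AE y in M. indicator {c<..} (f x y) * indicator (ball x t) y = (0::ennreal))"
      by (intro AE_cong) (auto simp: indicator_def)
    also have "\<dots> \<longleftrightarrow> (\<integral>\<^sup>+y\<in>ball x t. indicator {c<..} (f x y) \<partial>M) = 0"
      by (rule nn_integral_0_iff_AE[symmetric]) measurable
    finally show ?thesis .
  qed
  moreover have "(\<lambda>x. \<integral>\<^sup>+y\<in>ball x t. indicator {c<..} (f x y) \<partial>M) \<in> borel_measurable M"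
    by (rule set_nn_integral_ball_measurable) measurable
  then have "{x \<in> space M. (\<integral>\<^sup>+y\<in>ball x t. indicator {c<..} (f x y) \<partial>M) = 0} \<in> sets M"
    by measurable
  ultimately show "{x \<in> space M. esssup (restrict_space M (ball x t)) (f x) \<le> c} \<in> sets M"
    by simp
qed

text \<open>Balls have positive measure, so no ball fits into an exceptional null set. It supplies
  good intermediate points and good centers.\<close>

lemma AE_ex_in_ball:
  assumes "AE z in M. Q z" "0 < r"
  shows "\<exists>z\<in>ball x r. Q z"
proof (rule ccontr)
  assume *: "\<not> ?thesis"
  have "AE z in M. z \<notin> ball x r"
    using assms(1) by eventually_elim (use * in auto)
  then have "emeasure M (ball x r) = 0"
    by (subst (asm) AE_iff_measurable[of "ball x r"]) auto
  then show False
    using emeasure_ball_pos[OF assms(2), of x] by simp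
qed

end

section \<open>Mean oscillation over balls\<close>

text \<open>The quasi-norm for extended-valued functions, since mean oscillations may be infinite
  before finiteness is established.\<close>

definition eLp_norm :: "ennreal \<Rightarrow> 'a measure \<Rightarrow> ('a \<Rightarrow> ennreal) \<Rightarrow> ennreal" where
  "eLp_norm p M f =
     (if p = \<infinity> then esssup M f
      else ennreal_powr (\<integral>\<^sup>+x. ennreal_powr (f x) (enn2real p) \<partial>M) (1 / enn2real p))"

text \<open>The root 1/p is taken at each point, so that the Besov modulus becomes the L^p
  quasi-norm of this function, for p = infinity as well.\<close>

definition mean_oscillation ::
    "ennreal \<Rightarrow> 'a::metric_space measure \<Rightarrow> ('a \<Rightarrow> real) \<Rightarrow> real \<Rightarrow> 'a \<Rightarrow> ennreal" where
  "mean_oscillation p M u t x =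
     (if p = \<infinity> then esssup (restrict_space M (ball x t)) (\<lambda>y. ennreal \<bar>u x - u y\<bar>)
      else ennreal_powr (average M (ball x t) (\<lambda>y. ennreal (\<bar>u x - u y\<bar> powr enn2real p))) (1 / enn2real p))"

lemma Lp_norm_eq_eLp_norm: "Lp_norm p M f = eLp_norm p M (\<lambda>x. ennreal \<bar>f x\<bar>)"
  by (simp add: Lp_norm_def eLp_norm_def ennreal_powr_ennreal)

lemma besov_modulus_eq:
  assumes "0 < p"
  shows "besov_modulus p M u t = eLp_norm p M (mean_oscillation p M u t)"
  using enn2real_exponent_pos[OF assms]
  by (auto simp: besov_modulus_def eLp_norm_def mean_oscillation_def[abs_def] ennreal_powr_powr ennreal_powr_one)

lemma eLp_norm_mono_mult:
  assumes "0 < p" and [measurable]: "f \<in> borel_measurable M" "g \<in> borel_measurable M"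
    and le: "AE x in M. f x \<le> c * g x"
  shows "eLp_norm p M f \<le> c * eLp_norm p M g"
proof (cases "p = \<infinity>")
  case True
  have "AE x in M. f x \<le> c * esssup M g"
    using le esssup_AE[of g M] by eventually_elim (erule order_trans, rule mult_left_mono, auto)
  then show ?thesis
    using True by (simp add: eLp_norm_def esssup_I)
next
  case False
  define P where "P = enn2real p"
  have P: "0 < P"
    unfolding P_def using assms(1) False by (rule enn2real_exponent_pos)
  have "(\<integral>\<^sup>+x. ennreal_powr (f x) P \<partial>M) \<le> (\<integral>\<^sup>+x. ennreal_powr c P * ennreal_powr (g x) P \<partial>M)"
    using le by (intro nn_integral_mono_AE, elim eventually_mono)
      (use P in \<open>auto simp flip: ennreal_powr_mult intro!: ennreal_powr_mono\<close>)
  also have "\<dots> = ennreal_powr c P * (\<integral>\<^sup>+x. ennreal_powr (g x) P \<partial>M)"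
    by (simp add: nn_integral_cmult)
  finally have "ennreal_powr (\<integral>\<^sup>+x. ennreal_powr (f x) P \<partial>M) (1 / P)
     \<le> ennreal_powr (ennreal_powr c P * (\<integral>\<^sup>+x. ennreal_powr (g x) P \<partial>M)) (1 / P)"
    using P by (intro ennreal_powr_mono) auto
  then show ?thesis
    using False P
    by (simp add: eLp_norm_def ennreal_powr_mult ennreal_powr_powr ennreal_powr_one flip: P_def)
qed

lemma AE_finite_of_eLp_norm_finite:
  assumes "0 < p" and [measurable]: "f \<in> borel_measurable M" and fin: "eLp_norm p M f < top"
  shows "AE x in M. f x < top"
proof (cases "p = \<infinity>")
  case True
  then show ?thesis
    using esssup_AE[of f M] fin by (auto simp: eLp_norm_def elim: eventually_mono)
next
  case False
  then have "(\<integral>\<^sup>+x. ennreal_powr (f x) (enn2real p) \<partial>M) < top"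
    using fin by (simp add: eLp_norm_def)
  then have "AE x in M. ennreal_powr (f x) (enn2real p) \<noteq> \<infinity>"
    by (intro nn_integral_PInf_AE) (auto simp: less_top)
  then show ?thesis
    by eventually_elim (auto simp flip: less_top)
qed

lemma abs_add_powr_le:
  fixes a b :: real
  assumes "0 \<le> r"
  shows "ennreal (\<bar>a + b\<bar> powr r) \<le> ennreal (2 powr r) * (ennreal (\<bar>a\<bar> powr r) + ennreal (\<bar>b\<bar> powr r))"
proof -
  have "ennreal_powr (ennreal \<bar>a + b\<bar>) r \<le> ennreal_powr (ennreal \<bar>a\<bar> + ennreal \<bar>b\<bar>) r"
    using assms by (intro ennreal_powr_mono) (auto simp flip: ennreal_plus intro!: ennreal_leI)
  also have "\<dots> \<le> ennreal (2 powr r) * (ennreal_powr (ennreal \<bar>a\<bar>) r + ennreal_powr (ennreal \<bar>b\<bar>) r)"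
    by (rule ennreal_powr_add_le[OF assms])
  finally show ?thesis
    by (simp add: ennreal_powr_ennreal)
qed

text \<open>Enlarging the set increases the integral, and the comparison of measures pays for the
  changed normalisation.\<close>

lemma average_mono_set:
  assumes "A \<subseteq> B" and A: "0 < emeasure M A"
    and B: "0 < emeasure M B" "emeasure M B < top" and le: "emeasure M B \<le> c * emeasure M A"
  shows "average M A f \<le> c * average M B f"
proof -
  define I where "I = average M B f"
  have "(\<integral>\<^sup>+y\<in>A. f y \<partial>M) \<le> (\<integral>\<^sup>+y\<in>B. f y \<partial>M)"
    using assms(1) by (intro nn_integral_mono) (auto simp: indicator_def)
  also have "\<dots> = I * emeasure M B"
    unfolding I_def average_def using B by (simp add: ennreal_divide_times)
  also have "\<dots> \<le> I * (c * emeasure M A)"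
    by (intro mult_left_mono le) auto
  finally show ?thesis
    unfolding average_def[of M A] I_def[symmetric] using A
    by (intro divide_le_posI_ennreal) (auto simp: mult_ac)
qed

context doubling_space
begin

lemma mean_oscillation_measurable [measurable]:
  assumes [measurable]: "u \<in> borel_measurable M"
  shows "mean_oscillation p M u t \<in> borel_measurable M"
proof (cases "p = \<infinity>")
  case True
  have "(\<lambda>x. esssup (restrict_space M (ball x t)) (\<lambda>y. ennreal \<bar>u x - u y\<bar>)) \<in> borel_measurable M"
    by (rule esssup_ball_measurable) measurable
  then show ?thesis
    using True by (simp add: mean_oscillation_def[abs_def])
next
  case False
  have [measurable]: "(\<lambda>x. \<integral>\<^sup>+y\<in>ball x t. ennreal (\<bar>u x - u y\<bar> powr enn2real p) \<partial>M) \<in> borel_measurable M"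
    by (rule set_nn_integral_ball_measurable) measurable
  show ?thesis
    using False by (simp add: mean_oscillation_def[abs_def] average_def)
qed

lemma doubling_le: "0 < t \<Longrightarrow> T \<le> 2 * t \<Longrightarrow> emeasure M (ball x T) \<le> ennreal D * emeasure M (ball x t)"
  using doubling[of t x] emeasure_ball_mono[of x T x "2 * t"] by (auto intro: order_trans simp: subset_ball)

lemma emeasure_ball_shift_le:
  assumes "0 < t" "dist x y < t"
  shows "emeasure M (ball y (2 * t)) \<le> ennreal (D\<^sup>2) * emeasure M (ball x t)"
proof -
  have "ball y (2 * t) \<subseteq> ball x (4 * t)"
  proof
    fix z assume "z \<in> ball y (2 * t)"
    then show "z \<in> ball x (4 * t)"
      using dist_triangle[of x z y] assms by simp
  qed
  then show ?thesis
    using doubling_power[of t x 2] assms by (auto intro: order_trans dest!: emeasure_ball_mono)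
qed

text \<open>The bound runs only from the smaller radius to the larger: the larger ball also sees
  values of u that the smaller one misses. For finite p the constant is the change of normalisation,
  taken to the power 1/p; for p = infinity there is no normalisation and the constant is 1.\<close>

lemma mean_oscillation_mono:
  assumes "0 < p"
  shows "\<exists>K>0. \<forall>u t T x. u \<in> borel_measurable M \<longrightarrow> 0 < t \<longrightarrow> t \<le> T \<longrightarrow> T \<le> 2 * t \<longrightarrow>
    mean_oscillation p M u t x \<le> ennreal K * mean_oscillation p M u T x"
proof (cases "p = \<infinity>")
  case True
  have "mean_oscillation p M u t x \<le> ennreal 1 * mean_oscillation p M u T x"
    if [measurable]: "u \<in> borel_measurable M" and "t \<le> T" for u t T x
  proof -
    let ?f = "\<lambda>y. ennreal \<bar>u x - u y\<bar>"
    have "AE y in restrict_space M (ball x T). ?f y \<le> esssup (restrict_space M (ball x T)) ?f"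
      by (rule esssup_AE)
    then have "AE y in M. y \<in> ball x T \<longrightarrow> ?f y \<le> esssup (restrict_space M (ball x T)) ?f"
      by (simp add: AE_restrict_space_iff)
    then have "AE y in M. y \<in> ball x t \<longrightarrow> ?f y \<le> esssup (restrict_space M (ball x T)) ?f"
      by eventually_elim (use that in auto)
    then show ?thesis
      using True by (simp add: mean_oscillation_def)
        (intro esssup_I measurable_restrict_space1, auto simp: AE_restrict_space_iff)
  qed
  then show ?thesis
    by (intro exI[of _ 1]) auto
next
  case False
  define P where "P = enn2real p"
  have P: "0 < P"
    unfolding P_def using assms False by (rule enn2real_exponent_pos)
  have "mean_oscillation p M u t x \<le> ennreal (D powr (1 / P)) * mean_oscillation p M u T x"
    if "0 < t" "t \<le> T" "T \<le> 2 * t" for u t T x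
  proof -
    let ?f = "\<lambda>y. ennreal (\<bar>u x - u y\<bar> powr P)"
    have "average M (ball x t) ?f \<le> ennreal D * average M (ball x T) ?f"
      using that by (intro average_mono_set subset_ball emeasure_ball_pos emeasure_ball_finite doubling_le) auto
    then have "ennreal_powr (average M (ball x t) ?f) (1 / P)
        \<le> ennreal_powr (ennreal D * average M (ball x T) ?f) (1 / P)"
      using P by (intro ennreal_powr_mono) auto
    then show ?thesis
      using False D_ge_1 by (simp add: mean_oscillation_def ennreal_powr_mult ennreal_powr_ennreal flip: P_def)
  qed
  then show ?thesis
    using D_ge_1 by (intro exI[of _ "D powr (1 / P)"]) auto
qed

text \<open>Compare \<open>u x\<close> and \<open>u y\<close> with \<open>u z\<close> and average over \<open>z\<close> in the ball around \<open>x\<close> of radius \<open>t\<close>.\<close>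

lemma diff_le_mean_oscillation:
  assumes "0 < p"
  shows "\<exists>K>0. \<forall>u t x y. u \<in> borel_measurable M \<longrightarrow> dist x y < t \<longrightarrow>
    ennreal \<bar>u x - u y\<bar> \<le> ennreal K * (mean_oscillation p M u (2 * t) x + mean_oscillation p M u (2 * t) y)"
proof (cases "p = \<infinity>")
  case True
  have "ennreal \<bar>u x - u y\<bar> \<le> ennreal 1 * (mean_oscillation p M u (2 * t) x + mean_oscillation p M u (2 * t) y)"
    if u [measurable]: "u \<in> borel_measurable M" and xy: "dist x y < t" for u t x y
  proof -
    have t: "0 < t"
      using xy zero_le_dist[of x y] by linarith
    have osc: "AE z in M. z \<in> ball w (2 * t) \<longrightarrow> ennreal \<bar>u w - u z\<bar> \<le> mean_oscillation p M u (2 * t) w" for w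
      using esssup_AE[of "\<lambda>z. ennreal \<bar>u w - u z\<bar>" "restrict_space M (ball w (2 * t))"] True
      by (simp add: AE_restrict_space_iff mean_oscillation_def)
    have "AE z in M. (z \<in> ball x (2 * t) \<longrightarrow> ennreal \<bar>u x - u z\<bar> \<le> mean_oscillation p M u (2 * t) x) \<and>
        (z \<in> ball y (2 * t) \<longrightarrow> ennreal \<bar>u y - u z\<bar> \<le> mean_oscillation p M u (2 * t) y)"
      using osc[of x] osc[of y] by eventually_elim auto
    \<comment> \<open>For p = infinity averaging over z is replaced by choosing one z at which both
      essential bounds hold.\<close>
    from AE_ex_in_ball[OF this t, of x] obtain z where z: "dist x z < t"
      "z \<in> ball x (2 * t) \<longrightarrow> ennreal \<bar>u x - u z\<bar> \<le> mean_oscillation p M u (2 * t) x"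
      "z \<in> ball y (2 * t) \<longrightarrow> ennreal \<bar>u y - u z\<bar> \<le> mean_oscillation p M u (2 * t) y"
      by auto
    moreover have "dist y z < 2 * t"
      using xy z(1) dist_triangle[of y z x] by (simp add: dist_commute)
    moreover have "ennreal \<bar>u x - u y\<bar> \<le> ennreal \<bar>u x - u z\<bar> + ennreal \<bar>u y - u z\<bar>"
      by (auto simp flip: ennreal_plus intro!: ennreal_leI)
    ultimately show ?thesis
      using t by (auto intro: order_trans add_mono)
  qed
  then show ?thesis
    by (intro exI[of _ 1]) auto
next
  case False
  define P where "P = enn2real p"
  have P: "0 < P"
    unfolding P_def using assms False by (rule enn2real_exponent_pos)
  \<comment> \<open>\<open>2 powr P\<close> comes from splitting the difference at z and
    \<open>D\<^sup>2\<close> from enlarging the averaging balls; both are taken to the power 1/P.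
    The last factor is the price of distributing the root over a sum.\<close>
  define K where "K = (2 powr P * D\<^sup>2) powr (1 / P) * 2 powr (1 / P)"
  have "0 < K"
    using D_ge_1 by (simp add: K_def)
  moreover have "ennreal \<bar>u x - u y\<bar> \<le> ennreal K * (mean_oscillation p M u (2 * t) x + mean_oscillation p M u (2 * t) y)"
    if u [measurable]: "u \<in> borel_measurable M" and xy: "dist x y < t" for u t x y
  proof -
    have t: "0 < t"
      using xy zero_le_dist[of x y] by linarith
    define f where "f w z = ennreal (\<bar>u w - u z\<bar> powr P)" for w z
    have [measurable]: "f w \<in> borel_measurable M" for w
      unfolding f_def by measurable
    define V where "V = emeasure M (ball x t)"
    have V: "0 < V" "V < top"
      unfolding V_def using t emeasure_ball_pos emeasure_ball_finite by auto
    \<comment> \<open>As a function of z the left side is constant, so it may be integrated over the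
      ball and divided by V again.\<close>
    have "f x y * V = (\<integral>\<^sup>+z\<in>ball x t. f x y \<partial>M)"
      unfolding V_def by (simp add: nn_integral_cmult_indicator)
    also have "\<dots> \<le> (\<integral>\<^sup>+z\<in>ball x t. ennreal (2 powr P) * (f x z + f y z) \<partial>M)"
    proof (intro nn_integral_mono mult_right_mono)
      fix z
      show "f x y \<le> ennreal (2 powr P) * (f x z + f y z)"
        unfolding f_def using abs_add_powr_le[of P "u x - u z" "u z - u y"] P
        by (simp add: abs_minus_commute)
    qed auto
    also have "\<dots> = (\<integral>\<^sup>+z. ennreal (2 powr P) * (f x z * indicator (ball x t) z + f y z * indicator (ball x t) z) \<partial>M)"
      by (intro nn_integral_cong) (auto simp: indicator_def)
    also have "\<dots> = ennreal (2 powr P) * ((\<integral>\<^sup>+z\<in>ball x t. f x z \<partial>M) + (\<integral>\<^sup>+z\<in>ball x t. f y z \<partial>M))"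
      by (simp add: nn_integral_cmult nn_integral_add)
    finally have "f x y \<le> ennreal (2 powr P) * ((\<integral>\<^sup>+z\<in>ball x t. f x z \<partial>M) + (\<integral>\<^sup>+z\<in>ball x t. f y z \<partial>M)) / V"
      using V by (metis divide_right_mono_ennreal mult_divide_eq_ennreal less_irrefl)
    also have "\<dots> = ennreal (2 powr P) * (average M (ball x t) (f x) + average M (ball x t) (f y))"
      by (simp add: average_def V_def ennreal_times_divide flip: add_divide_distrib_ennreal)
    \<comment> \<open>Since dist x y < t, the ball of radius t around x lies in the ball of radius 2
      t around y, which turns the mean of \<open>f y\<close> into one centered at y. The term of x
      uses the same measure estimate with both centers equal to x.\<close>
    also have "\<dots> \<le> ennreal (2 powr P) * (ennreal (D\<^sup>2) * average M (ball x (2 * t)) (f x)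
        + ennreal (D\<^sup>2) * average M (ball y (2 * t)) (f y))"
    proof (intro mult_left_mono add_mono average_mono_set emeasure_ball_shift_le)
      show "ball x t \<subseteq> ball y (2 * t)"
      proof
        fix z assume "z \<in> ball x t"
        then show "z \<in> ball y (2 * t)"
          using dist_triangle[of y z x] xy by (simp add: dist_commute)
      qed
    qed (use t xy emeasure_ball_pos emeasure_ball_finite in auto)
    also have "\<dots> = ennreal (2 powr P * D\<^sup>2) * (average M (ball x (2 * t)) (f x) + average M (ball y (2 * t)) (f y))"
      by (simp add: ennreal_mult distrib_left mult.assoc)
    finally have "ennreal_powr (f x y) (1 / P)
        \<le> ennreal_powr (ennreal (2 powr P * D\<^sup>2) * (average M (ball x (2 * t)) (f x) + average M (ball y (2 * t)) (f y))) (1 / P)"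
      using P by (intro ennreal_powr_mono) auto
    also have "\<dots> = ennreal ((2 powr P * D\<^sup>2) powr (1 / P)) * ennreal_powr (average M (ball x (2 * t)) (f x) + average M (ball y (2 * t)) (f y)) (1 / P)"
      by (simp add: ennreal_powr_mult ennreal_powr_ennreal)
    also have "\<dots> \<le> ennreal ((2 powr P * D\<^sup>2) powr (1 / P)) * (ennreal (2 powr (1 / P)) *
        (ennreal_powr (average M (ball x (2 * t)) (f x)) (1 / P) + ennreal_powr (average M (ball y (2 * t)) (f y)) (1 / P)))"
      using P by (intro mult_left_mono ennreal_powr_add_le) auto
    also have "\<dots> = ennreal K * (mean_oscillation p M u (2 * t) x + mean_oscillation p M u (2 * t) y)"
      using False by (simp add: K_def ennreal_mult mult.assoc mean_oscillation_def f_def[abs_def] flip: P_def)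
    finally show ?thesis
      using P by (simp add: f_def ennreal_powr_ennreal powr_powr)
  qed
  ultimately show ?thesis
    by blast
qed

text \<open>Finite oscillation at x means that u differs from the constant \<open>u x\<close> by a
  function in L^p of the large ball, and constants are in L^p there because balls have finite
  measure.\<close>

lemma Lp_norm_ball_finite:
  assumes "0 < p" and u [measurable]: "u \<in> borel_measurable M"
    and osc: "mean_oscillation p M u T x < top" and sub: "ball x0 r \<subseteq> ball x T" and T: "0 < T"
  shows "Lp_norm p (restrict_space M (ball x0 r)) u < top"
proof (cases "p = \<infinity>")
  case True
  have "AE z in M. z \<in> ball x T \<longrightarrow> ennreal \<bar>u x - u z\<bar> \<le> mean_oscillation p M u T x"
    using esssup_AE[of "\<lambda>z. ennreal \<bar>u x - u z\<bar>" "restrict_space M (ball x T)"] True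
    by (simp add: AE_restrict_space_iff mean_oscillation_def)
  then have "AE z in M. z \<in> ball x0 r \<longrightarrow> ennreal \<bar>u z\<bar> \<le> ennreal \<bar>u x\<bar> + mean_oscillation p M u T x"
  proof eventually_elim
    case (elim z)
    have "ennreal \<bar>u z\<bar> \<le> ennreal \<bar>u x\<bar> + ennreal \<bar>u x - u z\<bar>"
      by (auto simp flip: ennreal_plus intro!: ennreal_leI)
    then show ?case
      using elim sub by (auto elim!: order_trans intro: add_left_mono)
  qed
  then have "esssup (restrict_space M (ball x0 r)) (\<lambda>z. ennreal \<bar>u z\<bar>) \<le> ennreal \<bar>u x\<bar> + mean_oscillation p M u T x"
    by (intro esssup_I measurable_restrict_space1) (auto simp: AE_restrict_space_iff)
  also have "\<dots> < top"
    using osc by simp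
  finally show ?thesis
    using True by (simp add: Lp_norm_def)
next
  case False
  define P where "P = enn2real p"
  have P: "0 < P"
    unfolding P_def using assms(1) False by (rule enn2real_exponent_pos)
  define f where "f z = ennreal (\<bar>u x - u z\<bar> powr P)" for z
  have [measurable]: "f \<in> borel_measurable M"
    unfolding f_def by measurable
  have "average M (ball x T) f < top"
    using osc False by (simp add: mean_oscillation_def f_def[abs_def] P_def)
  then have fin: "(\<integral>\<^sup>+z\<in>ball x T. f z \<partial>M) < top"
    using emeasure_ball_finite[of x T]
    by (auto simp: average_def ennreal_divide_eq_top_iff simp flip: less_top)
  have "(\<integral>\<^sup>+z\<in>ball x0 r. ennreal (\<bar>u z\<bar> powr P) \<partial>M)
      \<le> (\<integral>\<^sup>+z. ennreal (2 powr P) * (ennreal (\<bar>u x\<bar> powr P) * indicator (ball x T) z + f z * indicator (ball x T) z) \<partial>M)"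
  proof (rule nn_integral_mono)
    fix z
    show "ennreal (\<bar>u z\<bar> powr P) * indicator (ball x0 r) z
       \<le> ennreal (2 powr P) * (ennreal (\<bar>u x\<bar> powr P) * indicator (ball x T) z + f z * indicator (ball x T) z)"
      using abs_add_powr_le[of P "u x" "u z - u x"] P sub
      by (auto simp: indicator_def f_def abs_minus_commute)
  qed
  also have "\<dots> = ennreal (2 powr P) * (ennreal (\<bar>u x\<bar> powr P) * emeasure M (ball x T) + (\<integral>\<^sup>+z\<in>ball x T. f z \<partial>M))"
    by (simp add: nn_integral_cmult nn_integral_add)
  also have "\<dots> < top"
    using fin emeasure_ball_finite by (simp add: ennreal_mult_less_top)
  finally show ?thesis
    using False by (simp add: Lp_norm_def nn_integral_restrict_space flip: P_def)
qed

end

section \<open>Dyadic discretization of the Besov quasi-norm\<close>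

text \<open>Half-open as the distance scales in \<open>hajlasz_gradients\<close>, with real
  exponents so that the laws of \<open>powr\<close> apply.\<close>

definition dyadic_interval :: "int \<Rightarrow> real set" where
  "dyadic_interval k = {2 powr (- real_of_int k - 1)..<2 powr (- real_of_int k)}"

lemma ex_dyadic_interval:
  assumes "0 < t"
  shows "\<exists>k. t \<in> dyadic_interval k"
proof -
  \<comment> \<open>Chosen so that the left exponent - k - 1 is the integer part of
    \<open>log 2 t\<close>.\<close>
  define k where "k = - \<lfloor>log 2 t\<rfloor> - 1"
  have "- real_of_int k - 1 \<le> log 2 t" "log 2 t < - real_of_int k"
    unfolding k_def by linarith+
  then have "t \<in> dyadic_interval k"
    using assms by (simp add: dyadic_interval_def powr_le_iff less_powr_iff)
  then show ?thesis ..
qed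

lemma dyadic_interval_unique:
  assumes "t \<in> dyadic_interval j" "t \<in> dyadic_interval k"
  shows "j = k"
proof -
  have "(2::real) powr (- real_of_int j - 1) < 2 powr (- real_of_int k)"
    by (rule le_less_trans[of _ t]) (use assms in \<open>auto simp: dyadic_interval_def\<close>)
  moreover have "(2::real) powr (- real_of_int k - 1) < 2 powr (- real_of_int j)"
    by (rule le_less_trans[of _ t]) (use assms in \<open>auto simp: dyadic_interval_def\<close>)
  ultimately show ?thesis
    by simp
qed

lemma dyadic_interval_pos: "t \<in> dyadic_interval k \<Longrightarrow> 0 < t"
  unfolding dyadic_interval_def by (auto elim: less_le_trans[rotated])

lemma emeasure_dyadic_interval: "emeasure lborel (dyadic_interval k) = ennreal (2 powr (- real_of_int k - 1))"
proof -
  have "(2::real) powr (- k) = 2 * 2 powr (- real_of_int k - 1)"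
    by (simp add: powr_diff)
  then show ?thesis
    unfolding dyadic_interval_def by simp
qed

lemma nn_integral_dyadic_step:
  fixes c :: "int \<Rightarrow> ennreal"
  shows "(\<integral>\<^sup>+t. (\<integral>\<^sup>+k. c k * indicator (dyadic_interval k) t \<partial>count_space UNIV) \<partial>lborel)
     = (\<integral>\<^sup>+k. c k * ennreal (2 powr (- real_of_int k - 1)) \<partial>count_space UNIV)"
proof -
  have [measurable]: "dyadic_interval k \<in> sets borel" for k
    by (simp add: dyadic_interval_def)
  show ?thesis
    by (subst nn_integral_count_space_nn_integral)
      (auto simp: nn_integral_cmult_indicator emeasure_dyadic_interval)
qed

text \<open>The bounding step function carries the measurability and is integrated exactly by
  \<open>nn_integral_dyadic_step\<close>. The integrand \<open>h\<close> enters only through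
  monotonicity of the integral, so the modulus can be treated without studying its measurability in
  t.\<close>

lemma nn_integral_le_dyadic:
  fixes c :: "int \<Rightarrow> ennreal"
  assumes "\<And>k t. t \<in> dyadic_interval k \<Longrightarrow> h t \<le> c k"
  shows "(\<integral>\<^sup>+t\<in>{0<..}. h t \<partial>lborel) \<le> (\<integral>\<^sup>+k. c k * ennreal (2 powr (- real_of_int k - 1)) \<partial>count_space UNIV)"
  unfolding nn_integral_dyadic_step[symmetric]
proof (rule nn_integral_mono)
  fix t :: real
  show "h t * indicator {0<..} t \<le> (\<integral>\<^sup>+k. c k * indicator (dyadic_interval k) t \<partial>count_space UNIV)"
  proof (cases "0 < t")
    case True
    then obtain k where k: "t \<in> dyadic_interval k"
      using ex_dyadic_interval by blast
    have "c k * indicator (dyadic_interval k) t \<le> (\<integral>\<^sup>+k. c k * indicator (dyadic_interval k) t \<partial>count_space UNIV)"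
      by (rule nn_integral_ge_point) simp
    then show ?thesis
      using True k assms[OF k] by (auto intro: order_trans)
  qed simp
qed

text \<open>The dyadic intervals are disjoint, so at a given t the sum has at most one nonzero
  term.\<close>

lemma dyadic_le_nn_integral:
  fixes c :: "int \<Rightarrow> ennreal"
  assumes "\<And>k t. t \<in> dyadic_interval k \<Longrightarrow> c k \<le> h t"
  shows "(\<integral>\<^sup>+k. c k * ennreal (2 powr (- real_of_int k - 1)) \<partial>count_space UNIV) \<le> (\<integral>\<^sup>+t\<in>{0<..}. h t \<partial>lborel)"
  unfolding nn_integral_dyadic_step[symmetric]
proof (rule nn_integral_mono)
  fix t :: real
  show "(\<integral>\<^sup>+k. c k * indicator (dyadic_interval k) t \<partial>count_space UNIV) \<le> h t * indicator {0<..} t"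
  proof (cases "0 < t")
    case True
    then obtain k where k: "t \<in> dyadic_interval k"
      using ex_dyadic_interval by blast
    have "(\<integral>\<^sup>+j. c j * indicator (dyadic_interval j) t \<partial>count_space UNIV)
        = (\<integral>\<^sup>+j. c k * indicator {k} j \<partial>count_space UNIV)"
      using k dyadic_interval_unique by (intro nn_integral_cong) (auto simp: indicator_def)
    also have "\<dots> = c k"
      by (simp add: nn_integral_cmult_indicator)
    finally show ?thesis
      using True assms[OF k] by simp
  next
    case False
    then have "(\<integral>\<^sup>+j. c j * indicator (dyadic_interval j) t \<partial>count_space UNIV) = (\<integral>\<^sup>+j. 0 \<partial>count_space (UNIV :: int set))"
      by (intro nn_integral_cong) (auto dest: dyadic_interval_pos simp: indicator_def)
    then show ?thesis
      by simp
  qed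
qed

definition dyadic_moduli :: "real \<Rightarrow> (real \<Rightarrow> ennreal) \<Rightarrow> int \<Rightarrow> ennreal" where
  "dyadic_moduli s w k = ennreal (2 powr (s * k)) * w (2 powr (- real_of_int k))"

text \<open>On each dyadic interval the modulus is largest, up to K, at the right end point, and the
  negative power of t at the left one. This mismatch of end points costs the factor
  \<open>2 powr s\<close>.\<close>

lemma besov_norm_le_dyadic:
  assumes q: "0 < q" and s: "0 < s" and K: "0 < K"
    and w: "\<And>t T. 0 < t \<Longrightarrow> t \<le> T \<Longrightarrow> T \<le> 2 * t \<Longrightarrow> besov_modulus p M u t \<le> ennreal K * besov_modulus p M u T"
  shows "besov_norm M s p q u \<le> ennreal (K * 2 powr s) * lq_norm q (dyadic_moduli s (besov_modulus p M u))"
proof -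
  define W where "W = besov_modulus p M u"
  have step: "W t \<le> ennreal K * W (2 powr (- real_of_int k))" if "t \<in> dyadic_interval k" for t k
  proof -
    have "(2::real) powr (- k) = 2 * 2 powr (- real_of_int k - 1)"
      by (simp add: powr_diff)
    then show ?thesis
      using that dyadic_interval_pos[OF that] unfolding W_def
      by (intro w) (auto simp: dyadic_interval_def)
  qed
  show ?thesis
  proof (cases "q = \<infinity>")
    case True
    have "ennreal (t powr (- s)) * W t \<le> ennreal (K * 2 powr s) * (SUP k. dyadic_moduli s W k)" if "0 < t" for t
    proof -
      obtain k where k: "t \<in> dyadic_interval k"
        using ex_dyadic_interval \<open>0 < t\<close> by blast
      have "t powr (- s) \<le> (2 powr (- real_of_int k - 1)) powr (- s)"
        using k s by (intro powr_mono2') (auto simp: dyadic_interval_def)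
      also have "\<dots> = 2 powr s * 2 powr (s * k)"
        by (simp add: powr_powr powr_add[symmetric] algebra_simps)
      finally have "ennreal (t powr (- s)) * W t \<le> ennreal (2 powr s * 2 powr (s * k)) * (ennreal K * W (2 powr (- real_of_int k)))"
        using step[OF k] by (intro mult_mono ennreal_leI) auto
      also have "\<dots> = ennreal (K * 2 powr s) * dyadic_moduli s W k"
        using K by (simp add: dyadic_moduli_def ennreal_mult mult_ac)
      also have "\<dots> \<le> ennreal (K * 2 powr s) * (SUP k. dyadic_moduli s W k)"
        by (intro mult_left_mono SUP_upper) auto
      finally show ?thesis .
    qed
    then show ?thesis
      using True by (auto simp: besov_norm_def lq_norm_def W_def intro!: SUP_least)
  next
    case False
    define Q where "Q = enn2real q"
    have Q: "0 < Q"
      unfolding Q_def using q False by (rule enn2real_exponent_pos)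
    define h where "h t = ennreal_powr (W t) Q / ennreal (t powr (1 + s * Q))" for t
    \<comment> \<open>\<open>K powr Q\<close> belongs to the modulus; the power of 2 is the value of
      t^(-(1 + s Q)) at the left end point 2^(-k-1).\<close>
    define c where "c k = ennreal (K powr Q * 2 powr ((k + 1) * (1 + s * Q))) * ennreal_powr (W (2 powr (- real_of_int k))) Q" for k :: int
    have "h t \<le> c k" if k: "t \<in> dyadic_interval k" for t k
    proof -
      have t: "0 < t"
        by (rule dyadic_interval_pos[OF k])
      have "0 < s * Q"
        using s Q by simp
      then have "t powr (- (1 + s * Q)) \<le> (2 powr (- real_of_int k - 1)) powr (- (1 + s * Q))"
        using k by (intro powr_mono2') (auto simp: dyadic_interval_def)
      also have "\<dots> = 2 powr ((k + 1) * (1 + s * Q))"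
        by (simp add: powr_powr algebra_simps)
      finally have 1: "t powr (- (1 + s * Q)) \<le> 2 powr ((k + 1) * (1 + s * Q))" .
      have "h t = ennreal_powr (W t) Q * ennreal (t powr (- (1 + s * Q)))"
        using t by (simp add: h_def divide_ennreal_def inverse_ennreal flip: powr_minus)
      also have "\<dots> \<le> ennreal_powr (ennreal K * W (2 powr (- real_of_int k))) Q * ennreal (2 powr ((k + 1) * (1 + s * Q)))"
        using Q step[OF k] 1 by (intro mult_mono ennreal_powr_mono ennreal_leI) auto
      also have "\<dots> = c k"
        using K by (simp add: c_def ennreal_powr_mult ennreal_powr_ennreal ennreal_mult mult_ac)
      finally show ?thesis .
    qed
    then have "(\<integral>\<^sup>+t\<in>{0<..}. h t \<partial>lborel) \<le> (\<integral>\<^sup>+k. c k * ennreal (2 powr (- real_of_int k - 1)) \<partial>count_space UNIV)"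
      by (rule nn_integral_le_dyadic)
    also have "\<dots> = (\<integral>\<^sup>+k. ennreal ((K * 2 powr s) powr Q) * ennreal_powr (dyadic_moduli s W k) Q \<partial>count_space UNIV)"
    proof (rule nn_integral_cong)
      fix k :: int
      \<comment> \<open>The interval length 2^(-k-1) cancels the 1 in the exponent 1 + s Q, leaving
        2^((k+1) s Q).\<close>
      have "(K powr Q * 2 powr ((k + 1) * (1 + s * Q))) * 2 powr (- real_of_int k - 1) = (K * 2 powr s) powr Q * (2 powr (s * k)) powr Q"
        using K by (simp add: powr_mult powr_powr powr_add[symmetric] algebra_simps)
      then show "c k * ennreal (2 powr (- real_of_int k - 1)) = ennreal ((K * 2 powr s) powr Q) * ennreal_powr (dyadic_moduli s W k) Q"
        unfolding c_def dyadic_moduli_def ennreal_powr_mult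
        by (simp add: ennreal_powr_ennreal mult_ac flip: ennreal_mult)
    qed
    also have "\<dots> = ennreal ((K * 2 powr s) powr Q) * (\<integral>\<^sup>+k. ennreal_powr (dyadic_moduli s W k) Q \<partial>count_space UNIV)"
      by (simp add: nn_integral_cmult)
    finally have "ennreal_powr (\<integral>\<^sup>+t\<in>{0<..}. h t \<partial>lborel) (1 / Q) \<le>
        ennreal_powr (ennreal ((K * 2 powr s) powr Q) * (\<integral>\<^sup>+k. ennreal_powr (dyadic_moduli s W k) Q \<partial>count_space UNIV)) (1 / Q)"
      using Q by (intro ennreal_powr_mono) auto
    then show ?thesis
      using False Q K
      by (simp add: besov_norm_def lq_norm_def ennreal_powr_mult ennreal_powr_ennreal powr_powr h_def flip: W_def Q_def)
  qed
qed

text \<open>Here the modulus is bounded below on the k-th interval by its value at the left end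
  point 2^(-(k+1)), so the sequence with index k + 1 is estimated and then shifted back. For q =
  infinity, \<open>enn2real q\<close> is 0 and 1 / 0 is 0, so the constant reduces to
  \<open>K * 2 powr s\<close>.\<close>

lemma dyadic_le_besov_norm:
  assumes q: "0 < q" and s: "0 < s" and K: "0 < K"
    and w: "\<And>t T. 0 < t \<Longrightarrow> t \<le> T \<Longrightarrow> T \<le> 2 * t \<Longrightarrow> besov_modulus p M u t \<le> ennreal K * besov_modulus p M u T"
  shows "lq_norm q (dyadic_moduli s (besov_modulus p M u))
    \<le> ennreal (K * 2 powr (s + 1 / enn2real q)) * besov_norm M s p q u"
proof -
  define W where "W = besov_modulus p M u"
  show ?thesis
  proof (cases "q = \<infinity>")
    case True
    have "dyadic_moduli s W k \<le> ennreal (K * 2 powr s) * (SUP t\<in>{0<..}. ennreal (t powr (- s)) * W t)" for k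
    proof -
      define t :: real where "t = 2 powr (- real_of_int k)"
      have t: "0 < t"
        by (simp add: t_def)
      have "dyadic_moduli s W k = ennreal (t powr (- s)) * W t"
        by (simp add: dyadic_moduli_def t_def powr_powr mult.commute)
      \<comment> \<open>The supremum contains the dyadic radii, so nothing has to be compared;
        taking equal radii in \<open>w\<close> merely introduces K, which may be below 1, to reach
        the common constant.\<close>
      also have "\<dots> \<le> ennreal (t powr (- s)) * (ennreal K * W t)"
        unfolding W_def using w[of t t] t by (intro mult_left_mono) auto
      also have "\<dots> = ennreal K * (ennreal (t powr (- s)) * W t)"
        by (simp add: mult_ac)
      also have "\<dots> \<le> ennreal (K * 2 powr s) * (SUP t\<in>{0<..}. ennreal (t powr (- s)) * W t)"
        using t K s by (intro mult_mono SUP_upper ennreal_leI) (auto simp: ge_one_powr_ge_zero)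
      finally show ?thesis .
    qed
    then show ?thesis
      using True by (auto simp: besov_norm_def lq_norm_def W_def intro!: SUP_least)
  next
    case False
    define Q where "Q = enn2real q"
    have Q: "0 < Q"
      unfolding Q_def using q False by (rule enn2real_exponent_pos)
    \<comment> \<open>Weight times length on the k-th interval is 2^(s k Q - 1), while index k + 1
      requires 2^(s (k+1) Q). The quotient is 2^(s Q + 1), and its Q-th root is the power of 2 in
      C.\<close>
    define C where "C = K * 2 powr (s + 1 / Q)"
    have C: "0 < C"
      using K by (simp add: C_def)
    define h where "h t = ennreal_powr (W t) Q / ennreal (t powr (1 + s * Q))" for t
    \<comment> \<open>The power of 2 is t^(-(1 + s Q)) at the right end point, where it is smallest;
      the factor K of the modulus comparison is moved to this side.\<close>
    define c where "c k = ennreal (K powr (- Q) * 2 powr (k * (1 + s * Q))) * ennreal_powr (W (2 powr (- real_of_int k - 1))) Q" for k :: int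
    have "c k \<le> h t" if k: "t \<in> dyadic_interval k" for t k
    proof -
      have t: "0 < t"
        by (rule dyadic_interval_pos[OF k])
      have "0 < s * Q"
        using s Q by simp
      then have "(2 powr (- real_of_int k)) powr (- (1 + s * Q)) \<le> t powr (- (1 + s * Q))"
        using k t by (intro powr_mono2') (auto simp: dyadic_interval_def)
      then have 1: "2 powr (k * (1 + s * Q)) \<le> t powr (- (1 + s * Q))"
        by (simp add: powr_powr algebra_simps)
      have "(2::real) powr (- k) = 2 * 2 powr (- real_of_int k - 1)"
        by (simp add: powr_diff)
      then have "W (2 powr (- real_of_int k - 1)) \<le> ennreal K * W t"
        using k unfolding W_def by (intro w) (auto simp: dyadic_interval_def)
      then have "ennreal_powr (W (2 powr (- real_of_int k - 1))) Q \<le> ennreal_powr (ennreal K * W t) Q"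
        using Q by (intro ennreal_powr_mono) auto
      then have "c k \<le> ennreal (K powr (- Q) * 2 powr (k * (1 + s * Q))) * ennreal_powr (ennreal K * W t) Q"
        unfolding c_def by (rule mult_left_mono) simp
      also have "\<dots> = ennreal (K powr (- Q) * K powr Q) * (ennreal_powr (W t) Q * ennreal (2 powr (k * (1 + s * Q))))"
        using K by (simp add: ennreal_powr_mult ennreal_powr_ennreal ennreal_mult mult_ac)
      also have "K powr (- Q) * K powr Q = 1"
        using K by (simp add: powr_add[symmetric])
      also have "ennreal 1 * (ennreal_powr (W t) Q * ennreal (2 powr (k * (1 + s * Q))))
          \<le> ennreal_powr (W t) Q * ennreal (t powr (- (1 + s * Q)))"
        using 1 by (auto intro!: mult_left_mono ennreal_leI)
      also have "\<dots> = h t"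
        using t by (simp add: h_def divide_ennreal_def inverse_ennreal flip: powr_minus)
      finally show ?thesis .
    qed
    then have 2: "(\<integral>\<^sup>+k. c k * ennreal (2 powr (- real_of_int k - 1)) \<partial>count_space UNIV) \<le> (\<integral>\<^sup>+t\<in>{0<..}. h t \<partial>lborel)"
      by (rule dyadic_le_nn_integral)
    have "(\<integral>\<^sup>+k. ennreal_powr (dyadic_moduli s W (k + 1)) Q \<partial>count_space UNIV)
        = (\<integral>\<^sup>+k. ennreal (C powr Q) * (c k * ennreal (2 powr (- real_of_int k - 1))) \<partial>count_space UNIV)"
    proof (rule nn_integral_cong)
      fix k :: int
      have "C powr Q * (K powr (- Q) * 2 powr (k * (1 + s * Q)) * 2 powr (- real_of_int k - 1)) = (2 powr (s * (k + 1))) powr Q"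
      proof -
        have "C powr Q = K powr Q * 2 powr (s * Q + 1)"
          using K Q by (simp add: C_def powr_mult powr_powr distrib_right)
        then have "C powr Q * (K powr (- Q) * 2 powr (k * (1 + s * Q)) * 2 powr (- real_of_int k - 1))
            = (K powr Q * K powr (- Q)) * (2 powr (s * Q + 1) * 2 powr (k * (1 + s * Q)) * 2 powr (- real_of_int k - 1))"
          by (simp only: mult_ac)
        moreover have "K powr Q * K powr (- Q) = 1"
          using K by (simp add: powr_add[symmetric])
        moreover have "(2::real) powr (s * Q + 1) * 2 powr (k * (1 + s * Q)) * 2 powr (- real_of_int k - 1) = (2 powr (s * (k + 1))) powr Q"
          by (simp add: powr_powr powr_add[symmetric] algebra_simps)
        ultimately show ?thesis
          by (simp only: mult_1)
      qed
      then have "ennreal_powr (dyadic_moduli s W (k + 1)) Q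
        = ennreal (C powr Q * (K powr (- Q) * 2 powr (k * (1 + s * Q)) * 2 powr (- real_of_int k - 1))) * ennreal_powr (W (2 powr (- real_of_int k - 1))) Q"
        by (simp add: dyadic_moduli_def ennreal_powr_mult ennreal_powr_ennreal)
      also have "\<dots> = ennreal (C powr Q) * (c k * ennreal (2 powr (- real_of_int k - 1)))"
        by (simp add: c_def ennreal_mult mult_ac)
      finally show "ennreal_powr (dyadic_moduli s W (k + 1)) Q = ennreal (C powr Q) * (c k * ennreal (2 powr (- real_of_int k - 1)))" .
    qed
    also have "\<dots> = ennreal (C powr Q) * (\<integral>\<^sup>+k. c k * ennreal (2 powr (- real_of_int k - 1)) \<partial>count_space UNIV)"
      by (simp add: nn_integral_cmult)
    also have "\<dots> \<le> ennreal (C powr Q) * (\<integral>\<^sup>+t\<in>{0<..}. h t \<partial>lborel)"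
      by (intro mult_left_mono 2) auto
    finally have "ennreal_powr (\<integral>\<^sup>+k. ennreal_powr (dyadic_moduli s W (k + 1)) Q \<partial>count_space UNIV) (1 / Q)
        \<le> ennreal_powr (ennreal (C powr Q) * (\<integral>\<^sup>+t\<in>{0<..}. h t \<partial>lborel)) (1 / Q)"
      using Q by (intro ennreal_powr_mono) auto
    then have "lq_norm q (\<lambda>k. dyadic_moduli s W (k + 1)) \<le> ennreal C * besov_norm M s p q u"
      using False Q C
      by (simp add: besov_norm_def lq_norm_def ennreal_powr_mult ennreal_powr_ennreal powr_powr h_def flip: W_def Q_def)
    then show ?thesis
      by (simp add: lq_norm_shift C_def W_def Q_def)
  qed
qed

section \<open>From gradients to moduli\<close>

text \<open>The dyadic scale of dist x y is k + i for some i that depends on the pair. The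
  dependence is removed later by a sum or supremum over all i. Equal points are excluded because
  distance 0 has no scale.\<close>

lemma hajlasz_gradient_dyadic:
  assumes g: "g \<in> hajlasz_gradients M s u" and s: "0 < s"
  shows "\<exists>N\<in>null_sets M. \<forall>k x y. x \<notin> N \<longrightarrow> y \<notin> N \<longrightarrow> x \<noteq> y \<longrightarrow> dist x y < 2 powr (- real_of_int k) \<longrightarrow>
    (\<exists>i::nat. \<bar>u x - u y\<bar> \<le> 2 powr (- s * (k + int i)) * (g (k + int i) x + g (k + int i) y))"
proof -
  obtain N where N: "N \<in> null_sets M" and grad: "\<And>k x y. x \<notin> N \<Longrightarrow> y \<notin> N \<Longrightarrow>
      2 powi (- k - 1) \<le> dist x y \<Longrightarrow> dist x y < 2 powi (- k) \<Longrightarrow>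
      \<bar>u x - u y\<bar> \<le> dist x y powr s * (g k x + g k y)"
    using g by (auto simp: hajlasz_gradients_def)
  have g0: "0 \<le> g k x" for k x
    using g by (auto simp: hajlasz_gradients_def)
  show ?thesis
  proof (intro bexI[OF _ N] allI impI)
    fix k x y assume xy: "x \<notin> N" "y \<notin> N" "x \<noteq> y" "dist x y < 2 powr (- real_of_int k)"
    obtain j where j: "dist x y \<in> dyadic_interval j"
      using ex_dyadic_interval[of "dist x y"] xy by auto
    \<comment> \<open>Strictness matters: - j - 1 < - k for integers means k <= j.\<close>
    have "(2::real) powr (- real_of_int j - 1) < 2 powr (- real_of_int k)"
      by (rule le_less_trans[of _ "dist x y"]) (use j xy in \<open>auto simp: dyadic_interval_def\<close>)
    then have "k \<le> j"
      by simp
    then obtain i where i: "j = k + int i"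
      using zle_iff_zadd by blast
    have "\<bar>u x - u y\<bar> \<le> dist x y powr s * (g j x + g j y)"
    proof (rule grad)
      show "2 powi (- j - 1) \<le> dist x y" "dist x y < 2 powi (- j)"
        using j powr_real_of_int'[of 2 "- j - 1"] powr_real_of_int'[of 2 "- j"]
        by (auto simp: dyadic_interval_def)
    qed (use xy in auto)
    also have "\<dots> \<le> (2 powr (- real_of_int j)) powr s * (g j x + g j y)"
      using j s g0 by (intro mult_right_mono powr_mono2) (auto simp: dyadic_interval_def)
    also have "(2 powr (- real_of_int j)) powr s = 2 powr (- s * j)"
      by (simp add: powr_powr mult.commute)
    finally show "\<exists>i::nat. \<bar>u x - u y\<bar> \<le> 2 powr (- s * (k + int i)) * (g (k + int i) x + g (k + int i) y)"
      using i by (intro exI[of _ i]) simp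
  qed
qed

context doubling_space
begin

text \<open>Boundedness on L^1 of averaging over balls. By Tonelli, \<open>H y\<close> is weighted
  by the integral of 1 / \<open>emeasure M (ball x t)\<close> over x in \<open>ball y t\<close>;
  there \<open>ball y t\<close> lies in \<open>ball x (2 * t)\<close>, so the integrand is at most D
  / \<open>emeasure M (ball y t)\<close> and the weight at most D.\<close>

lemma nn_integral_average_swap:
  assumes [measurable]: "H \<in> borel_measurable M" and t: "0 < t"
  shows "(\<integral>\<^sup>+x. average M (ball x t) H \<partial>M) \<le> ennreal D * (\<integral>\<^sup>+x. H x \<partial>M)"
proof -
  have V: "0 < emeasure M (ball x t)" "emeasure M (ball x t) < top" for x
    using t emeasure_ball_pos emeasure_ball_finite by auto
  define f where "f x y = H y * (indicator (ball x t) y / emeasure M (ball x t))" for x y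
  have [measurable]: "case_prod f \<in> borel_measurable (M \<Otimes>\<^sub>M M)"
    unfolding f_def case_prod_unfold by measurable
  have "average M (ball x t) H = (\<integral>\<^sup>+y. f x y \<partial>M)" for x
    unfolding average_def f_def by (simp add: ennreal_times_divide nn_integral_divide)
  then have "(\<integral>\<^sup>+x. average M (ball x t) H \<partial>M) = (\<integral>\<^sup>+x. \<integral>\<^sup>+y. f x y \<partial>M \<partial>M)"
    by simp
  also have "\<dots> = (\<integral>\<^sup>+y. \<integral>\<^sup>+x. f x y \<partial>M \<partial>M)"
    by (rule square.Fubini'[symmetric]) measurable
  also have "\<dots> \<le> (\<integral>\<^sup>+y. H y * ennreal D \<partial>M)"
  proof (rule nn_integral_mono)
    fix y
    have "(\<integral>\<^sup>+x. f x y \<partial>M) \<le> (\<integral>\<^sup>+x. H y * (ennreal D / emeasure M (ball y t)) * indicator (ball y t) x \<partial>M)"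
    proof (rule nn_integral_mono)
      fix x
      have "1 / emeasure M (ball x t) \<le> ennreal D / emeasure M (ball y t)" if "dist x y < t"
      proof (rule divide_le_posI_ennreal)
        have "ball y t \<subseteq> ball x (2 * t)"
        proof
          fix z assume "z \<in> ball y t"
          then show "z \<in> ball x (2 * t)"
            using dist_triangle[of x z y] that by simp
        qed
        then have "emeasure M (ball y t) \<le> ennreal D * emeasure M (ball x t)"
          using doubling[OF t, of x] emeasure_ball_mono by (blast intro: order_trans)
        then have "emeasure M (ball y t) / emeasure M (ball y t) \<le> ennreal D * emeasure M (ball x t) / emeasure M (ball y t)"
          by (rule divide_right_mono_ennreal)
        then show "1 \<le> emeasure M (ball x t) * (ennreal D / emeasure M (ball y t))"
          using V[of y] by (simp add: ennreal_times_divide mult.commute)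
      qed (rule V)
      then show "f x y \<le> H y * (ennreal D / emeasure M (ball y t)) * indicator (ball y t) x"
        by (auto simp: f_def indicator_def dist_commute intro: mult_left_mono)
    qed
    also have "\<dots> = H y * ennreal D"
      using V[of y] by (simp add: nn_integral_cmult_indicator del: ennreal_times_divide) (simp add: ennreal_divide_times mult.assoc)
    finally show "(\<integral>\<^sup>+x. f x y \<partial>M) \<le> H y * ennreal D" .
  qed
  also have "\<dots> = ennreal D * (\<integral>\<^sup>+x. H x \<partial>M)"
    by (simp add: nn_integral_multc) (simp add: mult.commute)
  finally show ?thesis .
qed

text \<open>The mean of H x + H y over y is \<open>H x\<close> plus a ball average of H; the first
  term gives 1 and the second D. It will be applied to p-th powers of differences of u.\<close>

lemma nn_integral_average_le:
  assumes [measurable]: "H \<in> borel_measurable M" and t: "0 < t" and N: "N \<in> null_sets M"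
    and le: "\<And>x y. x \<notin> N \<Longrightarrow> y \<notin> N \<Longrightarrow> dist x y < t \<Longrightarrow> f x y \<le> H x + H y"
  shows "(\<integral>\<^sup>+x. average M (ball x t) (f x) \<partial>M) \<le> ennreal (1 + D) * (\<integral>\<^sup>+x. H x \<partial>M)"
proof -
  have V: "0 < emeasure M (ball x t)" "emeasure M (ball x t) < top" for x
    using t emeasure_ball_pos emeasure_ball_finite by auto
  have [measurable]: "(\<lambda>x. average M (ball x t) H) \<in> borel_measurable M"
    using set_nn_integral_ball_measurable[of "\<lambda>x y. H y" t] unfolding average_def by simp
  have AE_N: "AE x in M. x \<notin> N"
    by (rule AE_not_in[OF N])
  have "AE x in M. average M (ball x t) (f x) \<le> H x + average M (ball x t) H"
    using AE_N
  proof eventually_elim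
    case (elim x)
    have "(\<integral>\<^sup>+y\<in>ball x t. f x y \<partial>M) \<le> (\<integral>\<^sup>+y. H x * indicator (ball x t) y + H y * indicator (ball x t) y \<partial>M)"
      using AE_N by (intro nn_integral_mono_AE, elim eventually_mono) (use elim le in \<open>auto simp: indicator_def\<close>)
    also have "\<dots> = H x * emeasure M (ball x t) + (\<integral>\<^sup>+y\<in>ball x t. H y \<partial>M)"
      by (simp add: nn_integral_add nn_integral_cmult_indicator)
    finally have "average M (ball x t) (f x) \<le> (H x * emeasure M (ball x t) + (\<integral>\<^sup>+y\<in>ball x t. H y \<partial>M)) / emeasure M (ball x t)"
      unfolding average_def by (rule divide_right_mono_ennreal)
    also have "\<dots> = H x + average M (ball x t) H"
      using V[of x] by (simp add: average_def add_divide_distrib_ennreal mult_divide_eq_ennreal)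
    finally show ?case .
  qed
  then have "(\<integral>\<^sup>+x. average M (ball x t) (f x) \<partial>M) \<le> (\<integral>\<^sup>+x. H x + average M (ball x t) H \<partial>M)"
    by (rule nn_integral_mono_AE)
  also have "\<dots> \<le> (\<integral>\<^sup>+x. H x \<partial>M) + ennreal D * (\<integral>\<^sup>+x. H x \<partial>M)"
    using nn_integral_average_swap[of H t] t by (simp add: nn_integral_add add_left_mono)
  also have "\<dots> = ennreal (1 + D) * (\<integral>\<^sup>+x. H x \<partial>M)"
    using D_ge_1 by (simp add: ennreal_plus distrib_right)
  finally show ?thesis .
qed

lemma dyadic_moduli_le_gradient_top:
  assumes u [measurable]: "u \<in> borel_measurable M" and g: "g \<in> hajlasz_gradients M s u" and s: "0 < s"
  shows "dyadic_moduli s (besov_modulus \<infinity> M u) k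
    \<le> ennreal 2 * (SUP i::nat. ennreal (2 powr (- (s / 2) * i)) * Lp_norm \<infinity> M (g (k + int i)))"
proof -
  define F where "F = (SUP i::nat. ennreal (2 powr (- (s / 2) * i)) * Lp_norm \<infinity> M (g (k + int i)))"
  define t :: real where "t = 2 powr (- real_of_int k)"
  have [measurable]: "g j \<in> borel_measurable M" and g0: "0 \<le> g j x" for j x
    using g by (auto simp: hajlasz_gradients_def)
  obtain N where N: "N \<in> null_sets M" and grad: "\<And>k x y. x \<notin> N \<Longrightarrow> y \<notin> N \<Longrightarrow> x \<noteq> y \<Longrightarrow> dist x y < 2 powr (- real_of_int k) \<Longrightarrow>
      \<exists>i::nat. \<bar>u x - u y\<bar> \<le> 2 powr (- s * (k + int i)) * (g (k + int i) x + g (k + int i) y)"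
    using hajlasz_gradient_dyadic[OF g s] by blast
  \<comment> \<open>There are countably many scales, so all essential bounds hold together off a
    single null set.\<close>
  define G where "G x \<longleftrightarrow> x \<notin> N \<and> (\<forall>j. ennreal (g j x) \<le> Lp_norm \<infinity> M (g j))" for x
  have "AE x in M. ennreal (g j x) \<le> Lp_norm \<infinity> M (g j)" for j
    using esssup_AE[of "\<lambda>x. ennreal \<bar>g j x\<bar>" M] g0 by (simp add: Lp_norm_def)
  then have "AE x in M. \<forall>j. ennreal (g j x) \<le> Lp_norm \<infinity> M (g j)"
    by (simp add: AE_all_countable)
  with AE_not_in[OF N] have AE_G: "AE x in M. G x"
    unfolding G_def by eventually_elim auto
  have pw: "ennreal \<bar>u x - u y\<bar> \<le> ennreal (2 powr (- s * k)) * (ennreal 2 * F)"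
    if xy: "G x" "G y" "dist x y < t" for x y
  proof (cases "x = y")
    case False
    then obtain i :: nat where i: "\<bar>u x - u y\<bar> \<le> 2 powr (- s * (k + int i)) * (g (k + int i) x + g (k + int i) y)"
      using grad[of x y k] xy unfolding G_def t_def by blast
    \<comment> \<open>Half of the decay in i is given up, so that the weight s / 2 is the same as
      for finite p.\<close>
    have "2 powr (- s * (k + int i)) = 2 powr (- s * k) * (2 powr (- (s / 2) * i) * 2 powr (- (s / 2) * i))"
      by (simp add: powr_add[symmetric] algebra_simps)
    also have "\<dots> \<le> 2 powr (- s * k) * (1 * 2 powr (- (s / 2) * i))"
      using s powr_mono[of "- (s / 2) * i" 0 2] by (intro mult_left_mono mult_right_mono) auto
    finally have w: "2 powr (- s * (k + int i)) \<le> 2 powr (- s * k) * 2 powr (- (s / 2) * i)"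
      by simp
    have "\<bar>u x - u y\<bar> \<le> 2 powr (- s * k) * 2 powr (- (s / 2) * i) * (g (k + int i) x + g (k + int i) y)"
      using i mult_right_mono[OF w, of "g (k + int i) x + g (k + int i) y"] g0[of "k + int i"] by simp
    then have "ennreal \<bar>u x - u y\<bar> \<le> ennreal (2 powr (- s * k)) * (ennreal (2 powr (- (s / 2) * i)) * (ennreal (g (k + int i) x) + ennreal (g (k + int i) y)))"
      using g0[of "k + int i"] by (simp add: ennreal_leI mult.assoc flip: ennreal_mult ennreal_plus)
    also have "\<dots> \<le> ennreal (2 powr (- s * k)) * (ennreal (2 powr (- (s / 2) * i)) * (Lp_norm \<infinity> M (g (k + int i)) + Lp_norm \<infinity> M (g (k + int i))))"
      using xy by (intro mult_left_mono add_mono) (auto simp: G_def)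
    also have "\<dots> = ennreal (2 powr (- s * k)) * (ennreal 2 * (ennreal (2 powr (- (s / 2) * i)) * Lp_norm \<infinity> M (g (k + int i))))"
      by (simp add: mult_2[symmetric] mult_ac)
    also have "\<dots> \<le> ennreal (2 powr (- s * k)) * (ennreal 2 * F)"
      unfolding F_def by (intro mult_left_mono SUP_upper) auto
    finally show ?thesis .
  qed simp
  have "esssup M (mean_oscillation \<infinity> M u t) \<le> ennreal (2 powr (- s * k)) * (ennreal 2 * F)"
  proof (rule esssup_I)
    show "AE x in M. mean_oscillation \<infinity> M u t x \<le> ennreal (2 powr (- s * k)) * (ennreal 2 * F)"
      using AE_G
    proof eventually_elim
      case (elim x)
      have "AE y in M. y \<in> ball x t \<longrightarrow> ennreal \<bar>u x - u y\<bar> \<le> ennreal (2 powr (- s * k)) * (ennreal 2 * F)"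
        using AE_G by eventually_elim (use elim pw in auto)
      then show ?case
        unfolding mean_oscillation_def if_P[OF refl]
        by (intro esssup_I measurable_restrict_space1) (auto simp: AE_restrict_space_iff)
    qed
  qed measurable
  then have "besov_modulus \<infinity> M u t \<le> ennreal (2 powr (- s * k)) * (ennreal 2 * F)"
    by (simp add: besov_modulus_eq eLp_norm_def)
  then have "dyadic_moduli s (besov_modulus \<infinity> M u) k \<le> ennreal (2 powr (s * k)) * (ennreal (2 powr (- s * k)) * (ennreal 2 * F))"
    unfolding dyadic_moduli_def t_def by (rule mult_left_mono) simp
  also have "\<dots> = ennreal 2 * F"
    by (simp add: mult.assoc[symmetric] powr_add[symmetric] flip: ennreal_mult)
  finally show ?thesis
    unfolding F_def .
qed

text \<open>Since the scale i varies with the pair of points, the p-th powers at all scales are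
  added into one function H that majorises them. Its integral is a geometric series, because half of
  the decay in i is set aside for its ratio.\<close>

lemma dyadic_moduli_le_gradient_finite:
  assumes s: "0 < s" and p: "0 < p" "p \<noteq> \<infinity>"
  shows "\<exists>C>0. \<forall>u g k. u \<in> borel_measurable M \<longrightarrow> g \<in> hajlasz_gradients M s u \<longrightarrow>
    dyadic_moduli s (besov_modulus p M u) k
      \<le> ennreal C * (SUP i::nat. ennreal (2 powr (- (s / 2) * i)) * Lp_norm p M (g (k + int i)))"
proof -
  define P where "P = enn2real p"
  have P: "0 < P"
    unfolding P_def using p by (rule enn2real_exponent_pos)
  define r :: real where "r = 2 powr (- (s * P / 2))"
  have r: "0 < r" "r < 1"
    using P s by (auto simp: r_def intro!: powr_less_one)
  define S where "S = 1 / (1 - r)"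
  have S: "0 < S" "(\<Sum>i. ennreal (r ^ i)) = ennreal S"
    using r by (auto simp: S_def intro!: suminf_ennreal_eq geometric_sums)
  \<comment> \<open>\<open>1 + D\<close> comes from averaging over balls, \<open>2 powr P\<close>
    from splitting g x + g y, and S from the geometric series.\<close>
  define B where "B = (1 + D) * (2 powr P * S)"
  have B: "0 < B"
    using D_ge_1 S by (simp add: B_def)
  have "dyadic_moduli s (besov_modulus p M u) k
      \<le> ennreal (B powr (1 / P)) * (SUP i::nat. ennreal (2 powr (- (s / 2) * i)) * Lp_norm p M (g (k + int i)))"
    if [measurable]: "u \<in> borel_measurable M" and g: "g \<in> hajlasz_gradients M s u" for u g k
  proof -
    define F where "F = (SUP i::nat. ennreal (2 powr (- (s / 2) * i)) * Lp_norm p M (g (k + int i)))"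
    define t :: real where "t = 2 powr (- real_of_int k)"
    have [measurable]: "g j \<in> borel_measurable M" and g0: "0 \<le> g j x" for j x
      using g by (auto simp: hajlasz_gradients_def)
    obtain N where N: "N \<in> null_sets M" and grad: "\<And>k x y. x \<notin> N \<Longrightarrow> y \<notin> N \<Longrightarrow> x \<noteq> y \<Longrightarrow> dist x y < 2 powr (- real_of_int k) \<Longrightarrow>
        \<exists>i::nat. \<bar>u x - u y\<bar> \<le> 2 powr (- s * (k + int i)) * (g (k + int i) x + g (k + int i) y)"
      using hajlasz_gradient_dyadic[OF g s] by blast
    define c where "c i = 2 powr P * 2 powr (- s * (k + int i) * P)" for i :: nat
    define h where "h i x = ennreal (c i) * ennreal (g (k + int i) x powr P)" for i x
    define H where "H x = (\<Sum>i. h i x)" for x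
    have [measurable]: "h i \<in> borel_measurable M" "H \<in> borel_measurable M" for i
      unfolding h_def H_def by measurable
    have h_le: "h i x \<le> H x" for i x
      unfolding H_def using sum_le_suminf[of "\<lambda>i. h i x" "{i}"] by simp
    have pw: "ennreal (\<bar>u x - u y\<bar> powr P) \<le> H x + H y" if xy: "x \<notin> N" "y \<notin> N" "dist x y < t" for x y
    proof (cases "x = y")
      case False
      then obtain i :: nat where i: "\<bar>u x - u y\<bar> \<le> 2 powr (- s * (k + int i)) * (g (k + int i) x + g (k + int i) y)"
        using grad[of x y k] xy unfolding t_def by blast
      define v where "v = 2 powr (- s * (k + int i))"
      have "\<bar>u x - u y\<bar> powr P \<le> (v * \<bar>g (k + int i) x + g (k + int i) y\<bar>) powr P"
        using i g0[of "k + int i"] P by (intro powr_mono2) (auto simp: v_def)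
      also have "\<dots> = 2 powr (- s * (k + int i) * P) * \<bar>g (k + int i) x + g (k + int i) y\<bar> powr P"
        by (simp add: v_def powr_mult powr_powr)
      finally have "ennreal (\<bar>u x - u y\<bar> powr P) \<le> ennreal (2 powr (- s * (k + int i) * P)) * ennreal (\<bar>g (k + int i) x + g (k + int i) y\<bar> powr P)"
        by (simp add: ennreal_leI flip: ennreal_mult)
      also have "\<dots> \<le> ennreal (2 powr (- s * (k + int i) * P)) *
          (ennreal (2 powr P) * (ennreal (\<bar>g (k + int i) x\<bar> powr P) + ennreal (\<bar>g (k + int i) y\<bar> powr P)))"
        using P by (intro mult_left_mono abs_add_powr_le) auto
      also have "\<dots> = h i x + h i y"
        using g0 by (simp add: h_def c_def ennreal_mult distrib_left mult_ac)
      also have "\<dots> \<le> H x + H y"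
        by (intro add_mono h_le)
      finally show ?thesis .
    qed simp
    have int_h: "(\<integral>\<^sup>+x. h i x \<partial>M) \<le> ennreal (2 powr P * 2 powr (- s * k * P)) * ennreal_powr F P * ennreal (r ^ i)" for i
    proof -
      define L where "L = Lp_norm p M (g (k + int i))"
      have L: "ennreal_powr L P = (\<integral>\<^sup>+x. ennreal (g (k + int i) x powr P) \<partial>M)"
        using p P g0 by (simp add: L_def Lp_norm_def ennreal_powr_powr ennreal_powr_one flip: P_def)
      \<comment> \<open>One half of the decay 2^(-s i P) becomes \<open>r ^ i\<close>, to be summed
        over i; the other half stays with the norm, so that the term is bounded by F.\<close>
      have "2 powr (- s * (k + int i) * P) = 2 powr (- s * k * P) * (r ^ i * (2 powr (- (s / 2) * i)) powr P)"
        by (simp add: r_def powr_powr powr_add[symmetric] powr_realpow[symmetric] algebra_simps)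
      then have c: "c i = 2 powr P * 2 powr (- s * k * P) * (r ^ i * (2 powr (- (s / 2) * i)) powr P)"
        by (simp add: c_def)
      have "(\<integral>\<^sup>+x. h i x \<partial>M) = ennreal (c i) * ennreal_powr L P"
        unfolding h_def L by (simp add: nn_integral_cmult)
      also have "\<dots> = ennreal (2 powr P * 2 powr (- s * k * P)) * ennreal_powr (ennreal (2 powr (- (s / 2) * i)) * L) P * ennreal (r ^ i)"
        using r by (simp add: c ennreal_powr_mult ennreal_powr_ennreal ennreal_mult mult_ac)
      also have "\<dots> \<le> ennreal (2 powr P * 2 powr (- s * k * P)) * ennreal_powr F P * ennreal (r ^ i)"
        using P unfolding F_def L_def by (intro mult_right_mono mult_left_mono ennreal_powr_mono SUP_upper) auto
      finally show ?thesis .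
    qed
    have "(\<integral>\<^sup>+x. H x \<partial>M) = (\<Sum>i. \<integral>\<^sup>+x. h i x \<partial>M)"
      unfolding H_def by (rule nn_integral_suminf) measurable
    also have "\<dots> \<le> (\<Sum>i. ennreal (2 powr P * 2 powr (- s * k * P)) * ennreal_powr F P * ennreal (r ^ i))"
      by (intro suminf_le int_h) auto
    also have "\<dots> = ennreal (2 powr P * 2 powr (- s * k * P)) * ennreal_powr F P * ennreal S"
      by (simp add: S)
    finally have int_H: "(\<integral>\<^sup>+x. H x \<partial>M) \<le> ennreal (2 powr P * 2 powr (- s * k * P)) * ennreal_powr F P * ennreal S" .
    have "(\<integral>\<^sup>+x. average M (ball x t) (\<lambda>y. ennreal (\<bar>u x - u y\<bar> powr P)) \<partial>M) \<le> ennreal (1 + D) * (\<integral>\<^sup>+x. H x \<partial>M)"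
      by (rule nn_integral_average_le[OF _ _ N]) (use pw in \<open>auto simp: t_def\<close>)
    also have "\<dots> \<le> ennreal (1 + D) * (ennreal (2 powr P * 2 powr (- s * k * P)) * ennreal_powr F P * ennreal S)"
      by (intro mult_left_mono int_H) auto
    also have "\<dots> = ennreal (B * 2 powr (- s * k * P)) * ennreal_powr F P"
      using D_ge_1 S by (simp add: B_def ennreal_mult mult_ac)
    finally have "ennreal_powr (\<integral>\<^sup>+x. average M (ball x t) (\<lambda>y. ennreal (\<bar>u x - u y\<bar> powr P)) \<partial>M) (1 / P)
        \<le> ennreal_powr (ennreal (B * 2 powr (- s * k * P)) * ennreal_powr F P) (1 / P)"
      using P by (intro ennreal_powr_mono) auto
    also have "\<dots> = ennreal (B powr (1 / P) * 2 powr (- s * k)) * F"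
      using P B by (simp add: ennreal_powr_mult ennreal_powr_ennreal ennreal_powr_powr ennreal_powr_one powr_mult powr_powr)
    finally have "besov_modulus p M u t \<le> ennreal (B powr (1 / P) * 2 powr (- s * k)) * F"
      using p by (simp add: besov_modulus_def flip: P_def)
    then have "dyadic_moduli s (besov_modulus p M u) k \<le> ennreal (2 powr (s * k)) * (ennreal (B powr (1 / P) * 2 powr (- s * k)) * F)"
      unfolding dyadic_moduli_def t_def by (rule mult_left_mono) simp
    also have "\<dots> = ennreal (2 powr (s * k) * (B powr (1 / P) * 2 powr (- s * k))) * F"
      by (simp add: mult.assoc[symmetric] flip: ennreal_mult)
    also have "2 powr (s * k) * (B powr (1 / P) * 2 powr (- s * k)) = B powr (1 / P)"
      by (simp add: powr_minus field_simps)
    finally show ?thesis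
      unfolding F_def .
  qed
  then show ?thesis
    using B by (intro exI[of _ "B powr (1 / P)"]) auto
qed

end

section \<open>Equivalence of the two quasi-norms\<close>

context doubling_space
begin

lemma lq_dyadic_moduli_le_gradient:
  assumes s: "0 < s" and p: "0 < p" and q: "0 < q"
  shows "\<exists>C>0. \<forall>u g. u \<in> borel_measurable M \<longrightarrow> g \<in> hajlasz_gradients M s u \<longrightarrow>
    lq_norm q (dyadic_moduli s (besov_modulus p M u)) \<le> ennreal C * lq_norm q (\<lambda>k. Lp_norm p M (g k))"
proof -
  have "\<exists>C>0. \<forall>u g k. u \<in> borel_measurable M \<longrightarrow> g \<in> hajlasz_gradients M s u \<longrightarrow>
    dyadic_moduli s (besov_modulus p M u) k
      \<le> ennreal C * (SUP i::nat. ennreal (2 powr (- (s / 2) * i)) * Lp_norm p M (g (k + int i)))"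
  proof (cases "p = \<infinity>")
    case True
    show ?thesis
      unfolding True by (intro exI[of _ 2] conjI allI impI dyadic_moduli_le_gradient_top s) auto
  next
    case False
    then show ?thesis
      by (rule dyadic_moduli_le_gradient_finite[OF s p])
  qed
  then obtain C1 where C1: "0 < C1" and le: "\<And>u g k. u \<in> borel_measurable M \<Longrightarrow> g \<in> hajlasz_gradients M s u \<Longrightarrow>
    dyadic_moduli s (besov_modulus p M u) k
      \<le> ennreal C1 * (SUP i::nat. ennreal (2 powr (- (s / 2) * i)) * Lp_norm p M (g (k + int i)))"
    by blast
  have "0 < s / 2"
    using s by simp
  from lq_norm_Hardy[OF q this] obtain C2 where C2: "0 < C2"
    and Hardy: "\<And>a b. \<forall>k. a k \<le> (SUP i::nat. ennreal (2 powr (- (s / 2) * i)) * b (k + int i)) \<Longrightarrow>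
      lq_norm q a \<le> ennreal C2 * lq_norm q b"
    by blast
  have "lq_norm q (dyadic_moduli s (besov_modulus p M u)) \<le> ennreal (C2 * C1) * lq_norm q (\<lambda>k. Lp_norm p M (g k))"
    if "u \<in> borel_measurable M" "g \<in> hajlasz_gradients M s u" for u g
  proof -
    \<comment> \<open>The constant C1 is absorbed into the sequence so that the Hardy inequality
      applies as it stands.\<close>
    have "lq_norm q (dyadic_moduli s (besov_modulus p M u)) \<le> ennreal C2 * lq_norm q (\<lambda>k. ennreal C1 * Lp_norm p M (g k))"
      using le[OF that] by (intro Hardy) (simp add: SUP_mult_left_ennreal mult_ac)
    also have "\<dots> \<le> ennreal C2 * (ennreal C1 * lq_norm q (\<lambda>k. Lp_norm p M (g k)))"
      by (intro mult_left_mono lq_norm_mono_mult[OF q]) auto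
    finally show ?thesis
      using C1 C2 by (simp add: ennreal_mult mult.assoc)
  qed
  then show ?thesis
    using C1 C2 by (intro exI[of _ "C2 * C1"]) auto
qed

lemma besov_modulus_mono:
  assumes p: "0 < p"
  shows "\<exists>K>0. \<forall>u t T. u \<in> borel_measurable M \<longrightarrow> 0 < t \<longrightarrow> t \<le> T \<longrightarrow> T \<le> 2 * t \<longrightarrow>
    besov_modulus p M u t \<le> ennreal K * besov_modulus p M u T"
proof -
  obtain K where K: "0 < K" "\<And>u t T x. u \<in> borel_measurable M \<Longrightarrow> 0 < t \<Longrightarrow> t \<le> T \<Longrightarrow> T \<le> 2 * t \<Longrightarrow>
      mean_oscillation p M u t x \<le> ennreal K * mean_oscillation p M u T x"
    using mean_oscillation_mono[OF p] by blast
  show ?thesis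
    unfolding besov_modulus_eq[OF p]
    by (intro exI[of _ K] conjI allI impI K(1) eLp_norm_mono_mult[OF p] mean_oscillation_measurable AE_I2 K(2))
qed

text \<open>The pointwise oscillation estimate holds for every pair of points; the exceptional set
  of the gradient consists only of points where some oscillation is infinite. Finite moduli make
  this set null.\<close>

lemma ex_gradient_le_dyadic_moduli:
  assumes s: "0 < s" and p: "0 < p" and q: "0 < q"
  shows "\<exists>C>0. \<forall>u. u \<in> borel_measurable M \<longrightarrow> (\<forall>k. dyadic_moduli s (besov_modulus p M u) k < top) \<longrightarrow>
    hajlasz_besov_norm M s p q u \<le> ennreal C * lq_norm q (dyadic_moduli s (besov_modulus p M u))"
proof -
  obtain K where K: "0 < K" and osc: "\<And>u t x y. u \<in> borel_measurable M \<Longrightarrow> dist x y < t \<Longrightarrow>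
    ennreal \<bar>u x - u y\<bar> \<le> ennreal K * (mean_oscillation p M u (2 * t) x + mean_oscillation p M u (2 * t) y)"
    using diff_le_mean_oscillation[OF p] by blast
  \<comment> \<open>One factor 2^s arises because the distance may be as small as 2^(-k-1), the
    other because the oscillation has radius 2^(1-k) and thus index k - 1.\<close>
  define C where "C = K * 2 powr (2 * s)"
  have "hajlasz_besov_norm M s p q u \<le> ennreal C * lq_norm q (dyadic_moduli s (besov_modulus p M u))"
    if u [measurable]: "u \<in> borel_measurable M" and fin: "\<And>k. dyadic_moduli s (besov_modulus p M u) k < top" for u
  proof -
    define v where "v k = mean_oscillation p M u (2 * 2 powr (- real_of_int k))" for k :: int
    have [measurable]: "v k \<in> borel_measurable M" for k
      unfolding v_def by measurable
    have shift: "2 * 2 powr (- real_of_int k) = 2 powr (- real_of_int (k - 1))" for k :: int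
      by (simp add: powr_diff powr_minus field_simps)
    have norm_v: "eLp_norm p M (v k) = besov_modulus p M u (2 powr (- real_of_int (k - 1)))" for k
      unfolding besov_modulus_eq[OF p] v_def shift ..
    have "eLp_norm p M (v k) < top" for k
      using fin[of "k - 1"] unfolding norm_v dyadic_moduli_def
      by (auto simp: ennreal_mult_less_top)
    then have "AE x in M. v k x < top" for k
      by (intro AE_finite_of_eLp_norm_finite[OF p]) auto
    then have "AE x in M. \<forall>k. v k x < top"
      by (simp add: AE_all_countable)
    then obtain N where N: "N \<in> null_sets M" and v_fin: "\<And>x k. x \<notin> N \<Longrightarrow> v k x < top"
      by (auto elim!: AE_E3)
    \<comment> \<open>Chosen so that K = (2^(-k-1))^s \<open>c k\<close>, the lower bound on the
      distance at scale k.\<close>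
    define c where "c k = K * 2 powr (s * (k + 1))" for k :: int
    have c: "0 < c k" for k
      using K by (simp add: c_def)
    \<comment> \<open>Where the oscillation is infinite, \<open>enn2real\<close> returns 0; such
      points lie in N.\<close>
    define g where "g k x = c k * enn2real (v k x)" for k x
    have "g \<in> hajlasz_gradients M s u"
      unfolding hajlasz_gradients_def
    proof (intro CollectI conjI allI bexI[OF _ N] impI)
      show "g k \<in> borel_measurable M" for k
        unfolding g_def by measurable
      show "0 \<le> g k x" for k x
        using c[of k] by (simp add: g_def)
      fix k x y
      assume xy: "x \<notin> N" "y \<notin> N" "2 powi (- k - 1) \<le> dist x y" "dist x y < 2 powi (- k)"
      have d: "2 powr (- real_of_int k - 1) \<le> dist x y" "dist x y < 2 powr (- real_of_int k)"
        using xy powr_real_of_int'[of 2 "- k - 1"] powr_real_of_int'[of 2 "- k"] by auto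
      have "ennreal \<bar>u x - u y\<bar> \<le> ennreal K * (v k x + v k y)"
        unfolding v_def by (rule osc[OF u d(2)])
      also have "\<dots> = ennreal (K * (enn2real (v k x) + enn2real (v k y)))"
        using v_fin xy K by (simp add: ennreal_mult ennreal_plus)
      finally have "\<bar>u x - u y\<bar> \<le> K * (enn2real (v k x) + enn2real (v k y))"
        using K by (subst (asm) ennreal_le_iff) auto
      also have "K = (2 powr (- real_of_int k - 1)) powr s * c k"
      proof -
        have "(2::real) powr ((- real_of_int k - 1) * s) * 2 powr (s * (k + 1)) = 1"
          by (simp add: powr_add[symmetric] algebra_simps)
        then show ?thesis
          by (simp add: c_def powr_powr)
      qed
      also have "\<dots> * (enn2real (v k x) + enn2real (v k y)) = (2 powr (- real_of_int k - 1)) powr s * (g k x + g k y)"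
        by (simp only: g_def distrib_left mult.assoc)
      also have "\<dots> \<le> dist x y powr s * (g k x + g k y)"
        using d s c[of k] by (intro mult_right_mono powr_mono2) (auto simp: g_def)
      finally show "\<bar>u x - u y\<bar> \<le> dist x y powr s * (g k x + g k y)" .
    qed
    then have "hajlasz_besov_norm M s p q u \<le> lq_norm q (\<lambda>k. Lp_norm p M (g k))"
      unfolding hajlasz_besov_norm_def by (rule INF_lower)
    also have "\<dots> \<le> ennreal C * lq_norm q (\<lambda>k. dyadic_moduli s (besov_modulus p M u) (k + (- 1)))"
    proof (rule lq_norm_mono_mult[OF q])
      fix k
      have "Lp_norm p M (g k) \<le> ennreal (c k) * eLp_norm p M (v k)"
        unfolding Lp_norm_eq_eLp_norm
      proof (rule eLp_norm_mono_mult[OF p])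
        show "(\<lambda>x. ennreal \<bar>g k x\<bar>) \<in> borel_measurable M"
          unfolding g_def by measurable
        show "AE x in M. ennreal \<bar>g k x\<bar> \<le> ennreal (c k) * v k x"
          using AE_not_in[OF N] by eventually_elim (use c[of k] v_fin in \<open>simp add: g_def ennreal_mult abs_mult\<close>)
      qed measurable
      also have "\<dots> = ennreal C * dyadic_moduli s (besov_modulus p M u) (k + (- 1))"
      proof -
        have "c k = C * 2 powr (s * real_of_int (k + (- 1)))"
          by (simp add: c_def C_def powr_add[symmetric] algebra_simps)
        then show ?thesis
          unfolding norm_v dyadic_moduli_def using K by (simp add: C_def ennreal_mult mult.assoc)
      qed
      finally show "Lp_norm p M (g k) \<le> ennreal C * dyadic_moduli s (besov_modulus p M u) (k + (- 1))" .
    qed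
    also have "lq_norm q (\<lambda>k. dyadic_moduli s (besov_modulus p M u) (k + (- 1))) = lq_norm q (dyadic_moduli s (besov_modulus p M u))"
      by (rule lq_norm_shift)
    finally show ?thesis .
  qed
  then show ?thesis
    using K by (intro exI[of _ C]) (auto simp: C_def)
qed

text \<open>A single large dyadic radius suffices: finiteness of its modulus makes the oscillation
  finite almost everywhere, hence at some point of the given ball, and around that point
  \<open>Lp_norm_ball_finite\<close> applies.\<close>

lemma mem_Lp_loc:
  assumes p: "0 < p" and u [measurable]: "u \<in> borel_measurable M"
    and fin: "\<And>k. dyadic_moduli s (besov_modulus p M u) k < top"
  shows "u \<in> Lp_loc p M"
  unfolding Lp_loc_def
proof (intro CollectI conjI allI impI u)
  fix x0 :: 'a and r :: real assume r: "0 < r"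
  \<comment> \<open>Any two points of \<open>ball x0 r\<close> are less than 2 r apart, so the ball
    of radius T = 2^n around any of its points contains it. This T is the dyadic radius of index -
    n.\<close>
  obtain n where n: "2 * r < 2 ^ n"
    using real_arch_pow[of 2 "2 * r"] by auto
  define T :: real where "T = 2 ^ n"
  have T: "T = 2 powr (- real_of_int (- int n))"
    by (simp add: T_def powr_realpow)
  have "eLp_norm p M (mean_oscillation p M u T) < top"
    using fin[of "- int n"] unfolding dyadic_moduli_def T besov_modulus_eq[OF p, symmetric]
    by (auto simp: ennreal_mult_less_top)
  then have "AE x in M. mean_oscillation p M u T x < top"
    by (intro AE_finite_of_eLp_norm_finite[OF p]) auto
  from AE_ex_in_ball[OF this r, of x0] obtain x where x: "dist x0 x < r" "mean_oscillation p M u T x < top"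
    by auto
  have "ball x0 r \<subseteq> ball x T"
  proof
    fix y assume "y \<in> ball x0 r"
    then show "y \<in> ball x T"
      using x(1) n dist_triangle[of x y x0] by (simp add: T_def dist_commute)
  qed
  then have "Lp_norm p (restrict_space M (ball x0 r)) u < top"
    by (intro Lp_norm_ball_finite[OF p u x(2)]) (auto simp: T_def)
  then show "Lp_norm p (restrict_space M (ball x0 r)) u < \<infinity>"
    by simp
qed

lemma hajlasz_besov_equivalence:
  assumes s: "0 < s" and p: "0 < p" and q: "0 < q"
  shows "hajlasz_besov_space M s p q = besov_space M s p q \<and>
    (\<exists>C::real. 0 < C \<and> (\<forall>u \<in> besov_space M s p q.
       hajlasz_besov_norm M s p q u \<le> ennreal C * besov_norm M s p q u \<and>
       besov_norm M s p q u \<le> ennreal C * hajlasz_besov_norm M s p q u))"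
proof -
  let ?A = "\<lambda>u. dyadic_moduli s (besov_modulus p M u)"
  obtain K where K: "0 < K" and mono: "\<And>u t T. u \<in> borel_measurable M \<Longrightarrow> 0 < t \<Longrightarrow> t \<le> T \<Longrightarrow> T \<le> 2 * t \<Longrightarrow>
      besov_modulus p M u t \<le> ennreal K * besov_modulus p M u T"
    using besov_modulus_mono[OF p] by blast
  define C1 where "C1 = K * 2 powr s"
  define C2 where "C2 = K * 2 powr (s + 1 / enn2real q)"
  have C12: "0 < C1" "0 < C2"
    using K by (auto simp: C1_def C2_def)
  have up: "besov_norm M s p q u \<le> ennreal C1 * lq_norm q (?A u)"
    and low: "lq_norm q (?A u) \<le> ennreal C2 * besov_norm M s p q u" if "u \<in> borel_measurable M" for u
    unfolding C1_def C2_def using mono[OF that] by (auto intro!: besov_norm_le_dyadic dyadic_le_besov_norm q s K)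
  obtain C3 where C3: "0 < C3" and grad: "\<And>u g. u \<in> borel_measurable M \<Longrightarrow> g \<in> hajlasz_gradients M s u \<Longrightarrow>
      lq_norm q (?A u) \<le> ennreal C3 * lq_norm q (\<lambda>k. Lp_norm p M (g k))"
    using lq_dyadic_moduli_le_gradient[OF s p q] by blast
  obtain C4 where C4: "0 < C4" and ex: "\<And>u. u \<in> borel_measurable M \<Longrightarrow> (\<And>k. ?A u k < top) \<Longrightarrow>
      hajlasz_besov_norm M s p q u \<le> ennreal C4 * lq_norm q (?A u)"
    using ex_gradient_le_dyadic_moduli[OF s p q] by blast
  have A_N: "lq_norm q (?A u) \<le> ennreal C3 * hajlasz_besov_norm M s p q u" if u: "u \<in> borel_measurable M" for u
  proof -
    \<comment> \<open>Dividing by the constant leaves a lower bound for every member of the infimum;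
      this includes the case without gradients, where the infimum is \<open>top\<close>.\<close>
    have "lq_norm q (?A u) / ennreal C3 \<le> hajlasz_besov_norm M s p q u"
      unfolding hajlasz_besov_norm_def
    proof (rule INF_greatest)
      fix g assume "g \<in> hajlasz_gradients M s u"
      from grad[OF u this] show "lq_norm q (?A u) / ennreal C3 \<le> lq_norm q (\<lambda>k. Lp_norm p M (g k))"
        using C3 by (intro divide_le_posI_ennreal) auto
    qed
    then have "ennreal C3 * (lq_norm q (?A u) / ennreal C3) \<le> ennreal C3 * hajlasz_besov_norm M s p q u"
      by (rule mult_left_mono) simp
    then show ?thesis
      using C3 by (simp add: ennreal_times_divide mult_divide_eq_ennreal mult.commute[of "ennreal C3"])
  qed
  have B_N: "besov_norm M s p q u \<le> ennreal (C1 * C3) * hajlasz_besov_norm M s p q u" if u: "u \<in> borel_measurable M" for u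
  proof -
    have "besov_norm M s p q u \<le> ennreal C1 * (ennreal C3 * hajlasz_besov_norm M s p q u)"
      by (rule order_trans[OF up[OF u] mult_left_mono[OF A_N[OF u]]]) simp
    then show ?thesis
      using C12 C3 by (simp add: ennreal_mult mult.assoc)
  qed
  \<comment> \<open>Unlike \<open>B_N\<close>, this direction needs a finite norm beforehand, since
    the construction of a gradient requires finite moduli.\<close>
  have N_B: "hajlasz_besov_norm M s p q u \<le> ennreal (C4 * C2) * besov_norm M s p q u"
    if u: "u \<in> borel_measurable M" and fin: "besov_norm M s p q u < \<infinity>" for u
  proof -
    have "lq_norm q (?A u) < top"
      using low[OF u] fin by (auto simp: ennreal_mult_less_top intro: le_less_trans)
    then have "?A u k < top" for k
      using component_le_lq_norm[OF q] by (rule le_less_trans[rotated])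
    then have "hajlasz_besov_norm M s p q u \<le> ennreal C4 * (ennreal C2 * besov_norm M s p q u)"
      by (intro order_trans[OF ex[OF u] mult_left_mono[OF low[OF u]]]) auto
    then show ?thesis
      using C12 C4 by (simp add: ennreal_mult mult.assoc)
  qed
  have "hajlasz_besov_space M s p q = besov_space M s p q"
  proof (intro equalityI subsetI)
    fix u assume "u \<in> hajlasz_besov_space M s p q"
    then have u: "u \<in> borel_measurable M" and fin: "hajlasz_besov_norm M s p q u < top"
      by (auto simp: hajlasz_besov_space_def)
    have "lq_norm q (?A u) < top"
      using A_N[OF u] fin by (auto simp: ennreal_mult_less_top intro: le_less_trans)
    then have "?A u k < top" for k
      using component_le_lq_norm[OF q] by (rule le_less_trans[rotated])
    then have "u \<in> Lp_loc p M"
      by (rule mem_Lp_loc[OF p u])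
    moreover have "besov_norm M s p q u < top"
      using B_N[OF u] fin by (auto simp: ennreal_mult_less_top intro: le_less_trans)
    ultimately show "u \<in> besov_space M s p q"
      by (simp add: besov_space_def)
  next
    fix u assume "u \<in> besov_space M s p q"
    then have u: "u \<in> borel_measurable M" and fin: "besov_norm M s p q u < \<infinity>"
      by (auto simp: besov_space_def Lp_loc_def)
    have "hajlasz_besov_norm M s p q u < top"
      using N_B[OF u fin] fin by (auto simp: ennreal_mult_less_top intro: le_less_trans)
    then show "u \<in> hajlasz_besov_space M s p q"
      using u by (simp add: hajlasz_besov_space_def)
  qed
  moreover have "\<exists>C::real. 0 < C \<and> (\<forall>u \<in> besov_space M s p q.
       hajlasz_besov_norm M s p q u \<le> ennreal C * besov_norm M s p q u \<and>
       besov_norm M s p q u \<le> ennreal C * hajlasz_besov_norm M s p q u)"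
  proof (intro exI conjI ballI)
    let ?C = "max (C4 * C2) (C1 * C3)"
    show "0 < ?C"
      using C12 C3 C4 by (simp add: less_max_iff_disj)
    fix u assume "u \<in> besov_space M s p q"
    then have u: "u \<in> borel_measurable M" and fin: "besov_norm M s p q u < \<infinity>"
      by (auto simp: besov_space_def Lp_loc_def)
    show "hajlasz_besov_norm M s p q u \<le> ennreal ?C * besov_norm M s p q u"
      by (rule order_trans[OF N_B[OF u fin]]) (auto intro!: mult_right_mono ennreal_leI)
    show "besov_norm M s p q u \<le> ennreal ?C * hajlasz_besov_norm M s p q u"
      by (rule order_trans[OF B_N[OF u]]) (auto intro!: mult_right_mono ennreal_leI)
  qed
  ultimately show ?thesis ..
qed

end

section \<open>Specialisation of the doubling condition to factor 2 and conclusion\<close>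

lemma doubling_metric_measure_imp_doubling_space:
  assumes "doubling_metric_measure M"
  shows "\<exists>D. doubling_space M D"
proof -
  obtain C n :: real where C: "1 < C" "0 < n" and
    doubling: "\<And>x r l. 0 < r \<Longrightarrow> 1 < l \<Longrightarrow> emeasure M (ball x (l * r)) \<le> ennreal (C * l powr n) * emeasure M (ball x r)"
    using assms unfolding doubling_metric_measure_def by blast
  have "doubling_space M (C * 2 powr n)"
  proof
    show "space M = UNIV" "sets borel \<subseteq> sets M"
      using assms by (auto simp: doubling_metric_measure_def regular_borel_measure_def)
    show "0 < emeasure M (ball x r)" if "0 < r" for x r
      using assms that by (simp add: doubling_metric_measure_def)
    show "emeasure M (ball x r) < top" for x r
    proof (cases "0 < r")
      case False
      then have "ball x r = {}"
        by simp
      then show ?thesis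
        by (simp only: emeasure_empty ennreal_zero_less_top)
    qed (use assms in \<open>simp add: doubling_metric_measure_def\<close>)
    have "1 * 1 \<le> C * 2 powr n"
      using C by (intro mult_mono) (auto simp: ge_one_powr_ge_zero)
    then show "1 \<le> C * 2 powr n"
      by simp
    show "emeasure M (ball x (2 * r)) \<le> ennreal (C * 2 powr n) * emeasure M (ball x r)" if "0 < r" for x r
      using doubling[OF that, of 2] by simp
  qed
  then show ?thesis ..
qed

theorem theorem1p2:
  fixes M :: "'a::metric_space measure" and s :: real and p q :: ennreal
  assumes "doubling_metric_measure M" and "0 < s" and "0 < p" and "0 < q"
  shows "hajlasz_besov_space M s p q = besov_space M s p q \<and>
    (\<exists>C::real. 0 < C \<and> (\<forall>u \<in> besov_space M s p q.
       hajlasz_besov_norm M s p q u \<le> ennreal C * besov_norm M s p q u \<and>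
       besov_norm M s p q u \<le> ennreal C * hajlasz_besov_norm M s p q u))"
proof -
  obtain D where "doubling_space M D"
    using doubling_metric_measure_imp_doubling_space[OF assms(1)] ..
  then show ?thesis
    by (rule doubling_space.hajlasz_besov_equivalence[OF _ assms(2-4)])
qed

end
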